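(* Let $v\in\mathbb R^n$ with $v_1\ge v_2\ge\cdots\ge v_n\ge0$. Then the identified set $I(v;\Gamma^* )=\{\gamma\in\Gamma^*\mid v\in V^*(\gamma)\}$ for the symmetric parameter space $\Gamma^*$ is $$I(v;\Gamma^* )=\Big\{\gamma\in\Gamma^*\ \Big|\ \sum_{i=1}^n v_i\ge1\ \text{ and }\ \sum_{j\le k}v_j\le\sum_{j\le k}p(\gamma)^{j-1}\ \text{ for all }k\in\{1,\dots,n\}\Big\},$$ where for $\gamma=(\overline x,\underline x,\lambda,c)$ we set $p(\gamma)=1-\dfrac{c}{\overline x-\underline z}$ with $\underline z=\lambda\overline x+(1-\lambda)\underline x-c$.
   Context: Model with parameters $(\overline x_i,\underline x_i,\lambda_i,c_i)_{i=1}^n$. There are $n\ge2$ boxes and a risk-neutral agent, Pandora. Box $i$ contains a reward $x_i\in\{\underline x_i,\overline x_i\}$, $0\le\underline x_i<\overline x_i\le1$, with prior probability $\lambda_i\in(0,1)$ of $\overline x_i$ and prior mean $\mu_i=\lambda_i\overline x_i+(1-\lambda_i)\underline x_i$. Opening box $i$ costs $c_i>0$, where $c_i<\lambda_i(\overline x_i-\underline x_i)$. A CDF $F_i$ on $[\underline x_i,\overline x_i]$ is feasible for box $i$ iff it has mean $\mu_i$; a CDF profile $F=(F_1,\dots,F_n)$ is feasible iff every $F_i$ is. Given $F$, the values $y_i\sim F_i$ are independent across boxes; opening box $i$ (possible at most once) costs $c_i$ and reveals $y_i$. A strategy is a (possibly mixed) sequential decision rule which, at each stage and depending on what has been observed,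 decides whether to stop and, if not, which unopened box to open next; at least one box must be opened (no outside option), and on stopping Pandora chooses one previously opened box. Her payoff is the value of the chosen box minus the total cost of the boxes opened; a strategy is optimal if it maximizes expected payoff. (With reservation values $z_i$ solving $c_i=\int_{z_i}^{\overline x_i}(y-z_i)dF_i(y)$, optimal strategies are those that open unopened boxes in decreasing order of reservation value, stop when the maximal observed value exceeds all reservation values of unopened boxes, and then choose the opened box with highest value; ties broken arbitrarily.) A search behavior is the vector $v\in\mathbb R^n$ with $v_i$ the probability that box $i$ is opened. It is feasible if induced by some feasible CDF profile $F$ together with some optimal (possibly mixed) strategy under $F$. For a parameter profile $\gamma$, $V^*(\gamma)$ is the set of feasible search behaviors. $\Gamma\subset\mathbb R^{4n}$ is any set of parameter profiles $(\overline x_i,\underline x_i,\lambda_i,c_i)_{i=1}^n$ with $0\le\underline x_i<\overline x_i\le1$, $\lambda_i\in(0,1)$ and $0<c_i<\lambda_i(\overline x_i-\underline x_i)$ for all $i$, satisfying $\min_i(\overline x_i-c_i/\lambda_i)\ge\max_i(\mu_i-c_i)$. $\Gamma^*\subset\Gamma$ is the set of all symmetric parameters in $\Gamma$: $\overline x_i=\overline x$, $\underline x_i=\underline x$, $\lambda_i=\lambda$, $c_i=c$ for all $i$; such an element is written $\gamma=(\overline x,\underline x,\lambda,c)$. *)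

theory Defs
  imports "HOL-Probability.Probability"
begin

section \<open>Parameters\<close>

text \<open>Boxes are indexed by \<open>{1..n}\<close>.  A vector with one entry per box is an element of
  \<open>extensional {1..n}\<close>, so that two vectors are equal iff they agree on \<open>{1..n}\<close>.\<close>

datatype box = Box (reward_high: real) (reward_low: real) (prob_high: real) (cost: real)

definition prior_mean :: "box \<Rightarrow> real" where
  "prior_mean b = prob_high b * reward_high b + (1 - prob_high b) * reward_low b"

definition admissible_box :: "box \<Rightarrow> bool" where
  "admissible_box b \<longleftrightarrow>
     0 \<le> reward_low b \<and> reward_low b < reward_high b \<and> reward_high b \<le> 1 \<and>
     0 < prob_high b \<and> prob_high b < 1 \<and>
     0 < cost b \<and> cost b < prob_high b * (reward_high b - reward_low b)"

definition admissible_profiles :: "nat \<Rightarrow> (nat \<Rightarrow> box) set" where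
  "admissible_profiles n =
     {\<gamma> \<in> {1..n} \<rightarrow>\<^sub>E Collect admissible_box.
        (MIN i\<in>{1..n}. reward_high (\<gamma> i) - cost (\<gamma> i) / prob_high (\<gamma> i))
          \<ge> (MAX i\<in>{1..n}. prior_mean (\<gamma> i) - cost (\<gamma> i))}"

definition symmetric_profiles :: "nat \<Rightarrow> (nat \<Rightarrow> box) set \<Rightarrow> (nat \<Rightarrow> box) set" where
  "symmetric_profiles n \<Gamma> = {\<gamma> \<in> \<Gamma>. \<exists>b. \<forall>i\<in>{1..n}. \<gamma> i = b}"


section \<open>Feasible distributions\<close>

text \<open>A CDF is represented by the Borel probability measure on the reals that it determines.\<close>

definition feasible_distribution :: "box \<Rightarrow> real measure \<Rightarrow> bool" where
  "feasible_distribution b M \<longleftrightarrow>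
     real_distribution M \<and>
     measure M {reward_low b..reward_high b} = 1 \<and>
     (\<integral>y. y \<partial>M) = prior_mean b"

definition feasible_profile :: "nat \<Rightarrow> (nat \<Rightarrow> box) \<Rightarrow> (nat \<Rightarrow> real measure) \<Rightarrow> bool" where
  "feasible_profile n \<gamma> F \<longleftrightarrow> (\<forall>i\<in>{1..n}. feasible_distribution (\<gamma> i) (F i))"


section \<open>Strategies\<close>

text \<open>\<open>Stop i\<close> means: stop searching and take the (previously opened) box \<open>i\<close>.  A history lists the
  opened boxes, in the order of opening, together with their revealed values.\<close>

datatype action = Open nat | Stop nat

type_synonym history = "(nat \<times> real) list"
type_synonym decision_rule = "history \<Rightarrow> action"

definition observed :: "(nat \<Rightarrow> real) \<Rightarrow> nat list \<Rightarrow> history" where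
  "observed y xs = map (\<lambda>i. (i, y i)) xs"

text \<open>No \<open>Stop\<close> is legal at the empty history, so at least one box is opened.\<close>

definition legal_rule :: "nat \<Rightarrow> decision_rule \<Rightarrow> bool" where
  "legal_rule n s \<longleftrightarrow>
     (\<forall>h. distinct (map fst h) \<and> fst ` set h \<subseteq> {1..n} \<longrightarrow>
        (case s h of
           Open i \<Rightarrow> i \<in> {1..n} - fst ` set h
         | Stop i \<Rightarrow> i \<in> fst ` set h))"

text \<open>A mixed strategy is a jointly measurable family of pure decision rules, indexed by the outcome
  \<open>u\<close> of a randomization device that is uniform on \<open>[0,1]\<close> and independent of the values in the
  boxes.  Pure strategies are those that do not depend on \<open>u\<close>.\<close>

type_synonym strategy = "real \<Rightarrow> decision_rule"

definition is_strategy :: "nat \<Rightarrow> strategy \<Rightarrow> bool" where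
  "is_strategy n \<sigma> \<longleftrightarrow>
     (\<forall>u. legal_rule n (\<sigma> u)) \<and>
     (\<forall>xs. distinct xs \<and> set xs \<subseteq> {1..n} \<longrightarrow>
        (\<lambda>(u, y). \<sigma> u (observed y xs))
          \<in> (borel \<Otimes>\<^sub>M PiM {1..n} (\<lambda>_. borel)) \<rightarrow>\<^sub>M count_space UNIV)"

definition step :: "decision_rule \<Rightarrow> (nat \<Rightarrow> real) \<Rightarrow> nat list \<Rightarrow> nat list" where
  "step s y xs = (case s (observed y xs) of Open i \<Rightarrow> xs @ [i] | Stop _ \<Rightarrow> xs)"

text \<open>A legal rule stops after opening at most \<open>n\<close> boxes, and stopping states are fixed points of
  \<open>step\<close>; so \<open>n\<close> steps give all boxes ever opened.  See \<open>legal_rule_stops\<close> below.\<close>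

definition opened :: "nat \<Rightarrow> decision_rule \<Rightarrow> (nat \<Rightarrow> real) \<Rightarrow> nat list" where
  "opened n s y = (step s y ^^ n) []"

definition chosen_value :: "nat \<Rightarrow> decision_rule \<Rightarrow> (nat \<Rightarrow> real) \<Rightarrow> real" where
  "chosen_value n s y =
     (case s (observed y (opened n s y)) of Stop i \<Rightarrow> y i | Open _ \<Rightarrow> 0)"

definition payoff :: "nat \<Rightarrow> (nat \<Rightarrow> box) \<Rightarrow> decision_rule \<Rightarrow> (nat \<Rightarrow> real) \<Rightarrow> real" where
  "payoff n \<gamma> s y = chosen_value n s y - (\<Sum>i\<in>set (opened n s y). cost (\<gamma> i))"

lemma legal_rule_stops:
  assumes "legal_rule n s"
  shows "distinct (opened n s y)" "set (opened n s y) \<subseteq> {1..n}"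
    "\<exists>i\<in>set (opened n s y). s (observed y (opened n s y)) = Stop i"
proof -
  have fst_obs: "map fst (observed y xs) = xs" "fst ` set (observed y xs) = set xs" for xs
    by (auto simp: observed_def image_image o_def)
  have inv: "distinct xs \<and> set xs \<subseteq> {1..n} \<and>
      (length xs = k \<or> (\<exists>i\<in>set xs. s (observed y xs) = Stop i))"
    if "xs = (step s y ^^ k) []" for k xs
    using that
  proof (induction k arbitrary: xs)
    case (Suc k)
    define ys where "ys = (step s y ^^ k) []"
    have xs: "xs = step s y ys" using Suc.prems by (simp add: ys_def)
    have ys: "distinct ys" "set ys \<subseteq> {1..n}"
      "length ys = k \<or> (\<exists>i\<in>set ys. s (observed y ys) = Stop i)"
      using Suc.IH[OF ys_def] by auto
    have "case s (observed y ys) of Open i \<Rightarrow> i \<in> {1..n} - set ys | Stop i \<Rightarrow> i \<in> set ys"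
      using assms ys(1,2) unfolding legal_rule_def by (metis fst_obs)
    then show ?case using ys by (auto simp: xs step_def split: action.splits)
  qed simp
  define xs where "xs = opened n s y"
  have xs: "distinct xs" "set xs \<subseteq> {1..n}"
      "length xs = n \<or> (\<exists>i\<in>set xs. s (observed y xs) = Stop i)"
    using inv[of xs n] by (simp_all add: xs_def opened_def)
  have "case s (observed y xs) of Open i \<Rightarrow> i \<in> {1..n} - set xs | Stop i \<Rightarrow> i \<in> set xs"
    using assms xs(1,2) unfolding legal_rule_def by (metis fst_obs)
  moreover have "set xs = {1..n}" if "length xs = n"
    using that xs(1,2) by (intro card_subset_eq) (auto simp: distinct_card)
  ultimately have "\<exists>i\<in>set xs. s (observed y xs) = Stop i"
    using xs(3) by (auto split: action.splits)
  with xs show "distinct (opened n s y)" "set (opened n s y) \<subseteq> {1..n}"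
    "\<exists>i\<in>set (opened n s y). s (observed y (opened n s y)) = Stop i"
    by (simp_all add: xs_def)
qed


section \<open>Optimality and search behavior\<close>

definition joint_law :: "nat \<Rightarrow> (nat \<Rightarrow> real measure) \<Rightarrow> (real \<times> (nat \<Rightarrow> real)) measure" where
  "joint_law n F = uniform_measure lborel {0..1} \<Otimes>\<^sub>M PiM {1..n} F"

definition expected_payoff ::
    "nat \<Rightarrow> (nat \<Rightarrow> box) \<Rightarrow> (nat \<Rightarrow> real measure) \<Rightarrow> strategy \<Rightarrow> real" where
  "expected_payoff n \<gamma> F \<sigma> = (\<integral>(u, y). payoff n \<gamma> (\<sigma> u) y \<partial>joint_law n F)"

definition optimal_strategy ::
    "nat \<Rightarrow> (nat \<Rightarrow> box) \<Rightarrow> (nat \<Rightarrow> real measure) \<Rightarrow> strategy \<Rightarrow> bool" where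
  "optimal_strategy n \<gamma> F \<sigma> \<longleftrightarrow>
     is_strategy n \<sigma> \<and>
     (\<forall>\<tau>. is_strategy n \<tau> \<longrightarrow> expected_payoff n \<gamma> F \<tau> \<le> expected_payoff n \<gamma> F \<sigma>)"

definition search_behavior ::
    "nat \<Rightarrow> (nat \<Rightarrow> real measure) \<Rightarrow> strategy \<Rightarrow> nat \<Rightarrow> real" where
  "search_behavior n F \<sigma> =
     (\<lambda>i\<in>{1..n}. measure (joint_law n F)
        {(u, y) \<in> space (joint_law n F). i \<in> set (opened n (\<sigma> u) y)})"

definition feasible_search_behaviors :: "nat \<Rightarrow> (nat \<Rightarrow> box) \<Rightarrow> (nat \<Rightarrow> real) set" where
  "feasible_search_behaviors n \<gamma> =
     {search_behavior n F \<sigma> | F \<sigma>. feasible_profile n \<gamma> F \<and> optimal_strategy n \<gamma> F \<sigma>}"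

definition identified_set ::
    "nat \<Rightarrow> (nat \<Rightarrow> real) \<Rightarrow> (nat \<Rightarrow> box) set \<Rightarrow> (nat \<Rightarrow> box) set" where
  "identified_set n v \<Gamma> = {\<gamma> \<in> \<Gamma>. v \<in> feasible_search_behaviors n \<gamma>}"

definition z_low :: "box \<Rightarrow> real" where
  "z_low b = prob_high b * reward_high b + (1 - prob_high b) * reward_low b - cost b"

definition continuation_prob :: "box \<Rightarrow> real" where
  "continuation_prob b = 1 - cost b / (reward_high b - z_low b)"

end

theory Submission
  imports Defs "HOL-Combinatorics.Transposition"
begin

text \<open>Let \<open>z i\<close> be the reservation value of box \<open>i\<close> and \<open>y i\<close> its value, and call box \<open>i\<close> exposed if
  \<open>y i > z i\<close>.  Replacing the cost of each opened box by the expected excess of its value over \<open>z i\<close>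
  shows that the payoff of any strategy is in expectation the capped value \<open>min (y i) (z i)\<close> of the
  chosen box, minus the excesses of the boxes that are opened but not chosen.  An index rule maximizes
  this pathwise, hence an optimal strategy almost surely chooses every exposed box it opens, and so
  opens nothing after an exposed box.  As every box is exposed with probability at least \<open>1 - p\<close>, the
  probability of opening more than \<open>r\<close> boxes from a given set is at most \<open>p ^ r\<close>; summing over \<open>r\<close>
  gives the upper bounds.  Conversely, if every box has the two-point distribution on \<open>z_low\<close> and the
  high reward with reservation value \<open>z_low\<close>, then opening the boxes of any list in order until the
  high reward appears is optimal and opens the \<open>k\<close>-th box of the list with probability
  \<open>p ^ (k - 1)\<close>.  By a majorization argument the mixtures of these behaviors are all the vectors
  allowed by the bounds.\<close>

section \<open>Majorization and randomization\<close>

text \<open>The constant \<open>p\<close> comes from a single box. A reservation value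
  \<open>r\<close> can be found at or above \<open>z_low\<close>, because the expected excess over
  \<open>z_low\<close> is at least the mean minus \<open>z_low\<close>, which is the cost. The
  excess is positive only where \<open>y > r\<close> and is at most the high reward minus
  \<open>z_low\<close>; so the cost is at most this length times the probability of
  \<open>y > r\<close>, and that probability is at least \<open>1 - p\<close>. The extremal
  distribution turns both estimates into equalities.

  Ties shape the rest. Optimality is a statement about expectations and leaves many strategies, so
  necessity never classifies the optimal ones and uses only almost sure consequences of a comparison
  with one index rule. Sufficiency exploits ties: search may end before the boxes are exhausted,
  which is why the total number of openings is bounded below by 1 instead of being prescribed. The
  upper bound holds for every set of \<open>k\<close> boxes; for decreasing \<open>v\<close> the
  first \<open>k\<close> boxes are the binding ones.\<close>

lemma majorized_in_convex_symmetric: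
  fixes D :: "(nat \<Rightarrow> real) set" and v w :: "nat \<Rightarrow> real"
  assumes cong: "\<And>x x'. x \<in> D \<Longrightarrow> (\<And>i. i \<in> {1..n} \<Longrightarrow> x' i = x i) \<Longrightarrow> x' \<in> D"
    and convex: "\<And>x x' t. x \<in> D \<Longrightarrow> x' \<in> D \<Longrightarrow> 0 \<le> t \<Longrightarrow> t \<le> 1 \<Longrightarrow>
        (\<lambda>i. (1 - t) * x i + t * x' i) \<in> D"
    and symmetric: "\<And>x j k. x \<in> D \<Longrightarrow> j \<in> {1..n} \<Longrightarrow> k \<in> {1..n} \<Longrightarrow> x \<circ> Transposition.transpose j k \<in> D"
    and decreasing: "\<And>i j. 1 \<le> i \<Longrightarrow> i \<le> j \<Longrightarrow> j \<le> n \<Longrightarrow> v j \<le> v i"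
    and "w \<in> D"
    and "\<And>k. k \<in> {1..n} \<Longrightarrow> (\<Sum>j=1..k. v j) \<le> (\<Sum>j=1..k. w j)"
    and "(\<Sum>j=1..n. v j) = (\<Sum>j=1..n. w j)"
  shows "v \<in> D"
  using assms(5-7)
\<comment> \<open>Transfers in the style of Muirhead: each one moves \<open>w\<close> inside
  \<open>D\<close> towards \<open>v\<close> and makes at least one more entry agree. The entries of
  \<open>w\<close> may be in any order.\<close>
proof (induction "card {i\<in>{1..n}. v i \<noteq> w i}" arbitrary: w rule: less_induct)
  case less
  show ?case
  proof (cases "\<exists>k\<in>{1..n}. w k < v k")
    case False
    then have le: "v i \<le> w i" if "i \<in> {1..n}" for i
      using that by force
    have "v i = w i" if "i \<in> {1..n}" for i
      using sum_mono_inv[OF less.prems(3) le that] by simp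
    with cong[OF less.prems(1)] show ?thesis by blast
  next
    case True
    \<comment> \<open>With \<open>k\<close> least, \<open>v i \<le> w i\<close> holds at all earlier
      entries; the prefix bound at \<open>k\<close> then forces \<open>v j < w j\<close> at some
      earlier \<open>j\<close>.\<close>
    define k where "k = (LEAST k. k \<in> {1..n} \<and> w k < v k)"
    have k: "k \<in> {1..n}" "w k < v k"
      using LeastI_ex[of "\<lambda>k. k \<in> {1..n} \<and> w k < v k"] True unfolding k_def by blast+
    have before_k: "v i \<le> w i" if "i \<in> {1..n}" "i < k" for i
      using not_less_Least[of i "\<lambda>k. k \<in> {1..n} \<and> w k < v k"] that unfolding k_def by force
    define J where "J = {j\<in>{1..n}. j < k \<and> v j < w j}"
    have "J \<noteq> {}"
    proof
      assume "J = {}"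
      then have "\<not> v i < w i" if "i \<in> {1..n}" "i < k" for i
        using that by (auto simp: J_def)
      then have "w i \<le> v i" if "i \<in> {1..k}" for i
        using that k by (cases "i < k") (auto simp: not_less)
      then have "(\<Sum>j=1..k. w j) < (\<Sum>j=1..k. v j)"
        using k by (intro sum_strict_mono_ex1) auto
      with less.prems(2)[OF k(1)] show False by simp
    qed
    then obtain j where j: "j \<in> {1..n}" "j < k" "v j < w j"
      by (auto simp: J_def)
    \<comment> \<open>The largest transfer from \<open>j\<close> to \<open>k\<close> that overshoots
      neither target. As \<open>w k < v k \<le> v j < w j\<close>, its result is a mixture, with the
      weight \<open>t\<close> below, of \<open>w\<close> and of \<open>w\<close> with the two
      entries exchanged.\<close>
    define \<delta> where "\<delta> = min (w j - v j) (v k - w k)"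
    have \<delta>: "0 < \<delta>" "\<delta> \<le> w j - v j" "\<delta> \<le> v k - w k" "\<delta> = w j - v j \<or> \<delta> = v k - w k"
      using j k by (auto simp: \<delta>_def)
    have "v k \<le> v j" using decreasing j k by simp
    define w' where "w' i = w i + (if i = j then - \<delta> else 0) + (if i = k then \<delta> else 0)" for i
    define t where "t = \<delta> / (w j - w k)"
    have t: "0 \<le> t" "t \<le> 1" "t * (w j - w k) = \<delta>"
      using \<delta> \<open>v k \<le> v j\<close> k j by (auto simp: t_def field_simps)
    have "w' = (\<lambda>i. (1 - t) * w i + t * (w \<circ> Transposition.transpose j k) i)"
      using t(3) j(2) by (auto simp: w'_def fun_eq_iff Transposition.transpose_def algebra_simps)
    then have "w' \<in> D"
      using convex[OF less.prems(1) symmetric[OF less.prems(1) j(1) k(1)] t(1,2)] by simp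
    have sums: "(\<Sum>i=1..r. w' i) =
        (\<Sum>i=1..r. w i) + (if j \<le> r then - \<delta> else 0) + (if k \<le> r then \<delta> else 0)" for r
      using j(1) k(1) by (simp add: w'_def sum.distrib)
    have prefix: "(\<Sum>i=1..r. v i) \<le> (\<Sum>i=1..r. w' i)" if "r \<in> {1..n}" for r
    \<comment> \<open>Only prefixes containing \<open>j\<close> but not \<open>k\<close> lose
      \<open>\<delta>\<close>. All their terms satisfy \<open>v i \<le> w i\<close>, so their slack
      is at least \<open>w j - v j\<close>.\<close>
    proof (cases "j \<le> r \<and> r < k")
      case True
      have "w j - v j \<le> (\<Sum>i=1..r. w i - v i)"
        using True j before_k that by (intro member_le_sum) auto
      then show ?thesis unfolding sums using True \<delta> by (simp add: sum_subtractf)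
    next
      case False
      then show ?thesis unfolding sums using less.prems(2)[OF that] j(2) by auto
    qed
    have total: "(\<Sum>i=1..n. v i) = (\<Sum>i=1..n. w' i)"
      unfolding sums using less.prems(3) j k by simp
    define E where "E x = {i\<in>{1..n}. v i \<noteq> x i}" for x
    have "E w' \<subseteq> E w" "j \<in> E w" "k \<in> E w"
      using j k by (auto simp: E_def w'_def split: if_splits)
    moreover have "j \<notin> E w' \<or> k \<notin> E w'"
      using \<delta>(4) j(2) by (auto simp: E_def w'_def)
    ultimately have "E w' \<subset> E w" by blast
    then have "card {i\<in>{1..n}. v i \<noteq> w' i} < card {i\<in>{1..n}. v i \<noteq> w i}"
      unfolding E_def by (intro psubset_card_mono) auto
    from less.hyps[OF this \<open>w' \<in> D\<close> prefix total] show ?thesis by simp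
  qed
qed

text \<open>Consecutive half-open intervals of lengths \<open>a s\<close> are laid out from 0. The
  total mass is left arbitrary so that the induction can append the interval of the new element at
  the right end.\<close>

lemma finite_law_on_interval:
  fixes a :: "'a \<Rightarrow> real"
  assumes "finite S" "\<And>s. s \<in> S \<Longrightarrow> 0 \<le> a s"
  shows "\<exists>X \<in> borel \<rightarrow>\<^sub>M count_space UNIV. (\<forall>u\<in>{0<..sum a S}. X u \<in> S) \<and>
    (\<forall>s\<in>S. measure lborel {u\<in>{0<..sum a S}. X u = s} = a s)"
  using assms
proof (induction S rule: finite_induct)
  case empty
  show ?case by (intro bexI[of _ "\<lambda>_. undefined"]) auto
next
  case (insert s0 S)
  then obtain X where X[measurable]: "X \<in> borel \<rightarrow>\<^sub>M count_space UNIV"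
    and X_in: "\<forall>u\<in>{0<..sum a S}. X u \<in> S"
    and law: "\<forall>s\<in>S. measure lborel {u\<in>{0<..sum a S}. X u = s} = a s"
    by auto
  define Y where "Y u = (if u \<le> sum a S then X u else s0)" for u
  have "Y \<in> borel \<rightarrow>\<^sub>M count_space UNIV" unfolding Y_def by measurable
  moreover have total: "sum a (insert s0 S) = a s0 + sum a S" "0 \<le> a s0" "0 \<le> sum a S"
    using insert by (auto intro: sum_nonneg)
  moreover have "{u\<in>{0<..a s0 + sum a S}. Y u = s0} = {sum a S<..a s0 + sum a S}"
    using X_in insert(2) total by (force simp: Y_def)
  moreover have "{u\<in>{0<..a s0 + sum a S}. Y u = s} = {u\<in>{0<..sum a S}. X u = s}" if "s \<in> S" for s
    using that insert(2) total by (auto simp: Y_def)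
  ultimately show ?case
    using X_in law by (intro bexI[of _ Y]) (auto simp: Y_def)
qed

lemma finite_law_uniform:
  fixes a :: "'a \<Rightarrow> real"
  assumes "finite S" "\<And>s. s \<in> S \<Longrightarrow> 0 \<le> a s" "sum a S = 1"
  obtains X where "X \<in> borel \<rightarrow>\<^sub>M count_space UNIV" "\<And>u. X u \<in> S"
    "\<And>s. s \<in> S \<Longrightarrow> measure (uniform_measure lborel {0..1::real}) {u. X u = s} = a s"
proof -
  have "\<exists>X \<in> borel \<rightarrow>\<^sub>M count_space UNIV. (\<forall>u\<in>{0<..1::real}. X u \<in> S) \<and>
      (\<forall>s\<in>S. measure lborel {u\<in>{0<..1}. X u = s} = a s)"
    by (rule finite_law_on_interval[of S a, unfolded assms(3), OF assms(1)]) (rule assms(2))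
  then obtain X where X[measurable]: "X \<in> borel \<rightarrow>\<^sub>M count_space UNIV"
    and X_in: "\<forall>u\<in>{0<..1::real}. X u \<in> S"
    and law: "\<forall>s\<in>S. measure lborel {u\<in>{0<..1}. X u = s} = a s"
    by blast
  obtain s0 where s0: "s0 \<in> S" using assms(3) by fastforce
  \<comment> \<open>A strategy must be legal for every real \<open>u\<close>, so values of
    \<open>X\<close> outside \<open>S\<close>, possible only off \<open>(0, 1]\<close>, are
    redirected into \<open>S\<close>.\<close>
  define Y where "Y u = (if X u \<in> S then X u else s0)" for u
  have "(\<lambda>x. if x \<in> S then x else s0) \<circ> X \<in> borel \<rightarrow>\<^sub>M count_space UNIV"
    by (rule measurable_comp[OF X]) simp
  then have [measurable]: "Y \<in> borel \<rightarrow>\<^sub>M count_space UNIV"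
    by (simp add: Y_def[abs_def] comp_def)
  have "measure (uniform_measure lborel {0..1::real}) {u. Y u = s} = a s" if "s \<in> S" for s
  proof -
    have "measure (uniform_measure lborel {0..1::real}) {u. Y u = s} =
        measure lborel ({0..1} \<inter> {u. Y u = s})"
      by (subst measure_uniform_measure) auto
    also have "\<dots> = measure lborel {u\<in>{0<..1}. X u = s}"
    \<comment> \<open>The law was built on \<open>(0, 1]\<close>; the additional point 0 is a null
      set.\<close>
    proof (rule measure_eq_AE)
      show "AE u in lborel. u \<in> {0..1} \<inter> {u. Y u = s} \<longleftrightarrow> u \<in> {u\<in>{0<..1}. X u = s}"
        using AE_lborel_singleton[of "0::real"] by eventually_elim (use X_in in \<open>auto simp: Y_def\<close>)
    qed measurable
    finally show ?thesis using law that by simp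
  qed
  moreover have "Y u \<in> S" for u using s0 by (simp add: Y_def)
  ultimately show thesis using that[of Y] by simp
qed

section \<open>Pathwise behavior of decision rules\<close>

text \<open>The \<open>Open\<close> branch is a dummy: a legal rule has stopped after
  \<open>n\<close> steps.\<close>

definition chosen_box :: "nat \<Rightarrow> decision_rule \<Rightarrow> (nat \<Rightarrow> real) \<Rightarrow> nat" where
  "chosen_box n s y = (case s (observed y (opened n s y)) of Stop i \<Rightarrow> i | Open _ \<Rightarrow> 0)"

lemma map_fst_observed [simp]: "map fst (observed y xs) = xs"
  by (simp add: observed_def o_def)

lemma length_observed [simp]: "length (observed y xs) = length xs"
  by (simp add: observed_def)

lemma observed_Nil [simp]: "observed y [] = []"
  by (simp add: observed_def)

lemma set_observed: "set (observed y xs) = (\<lambda>i. (i, y i)) ` set xs"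
  by (simp add: observed_def)

lemma observed_cong: "(\<And>i. i \<in> set xs \<Longrightarrow> y i = y' i) \<Longrightarrow> observed y xs = observed y' xs"
  by (simp add: observed_def)

lemma legal_rule_observed:
  assumes "legal_rule n s" "distinct xs" "set xs \<subseteq> {1..n}"
  shows "case s (observed y xs) of Open i \<Rightarrow> i \<in> {1..n} - set xs | Stop i \<Rightarrow> i \<in> set xs"
  using assms unfolding legal_rule_def by (metis map_fst_observed set_map)

lemma iterated_step:
  assumes "legal_rule n s"
  shows "distinct ((step s y ^^ k) []) \<and> set ((step s y ^^ k) []) \<subseteq> {1..n}"
proof (induction k)
  case (Suc k)
  define xs where "xs = (step s y ^^ k) []"
  have "case s (observed y xs) of Open i \<Rightarrow> i \<in> {1..n} - set xs | Stop i \<Rightarrow> i \<in> set xs"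
    using Suc by (intro legal_rule_observed[OF assms]) (auto simp: xs_def)
  then have "distinct (step s y xs) \<and> set (step s y xs) \<subseteq> {1..n}"
    using Suc[folded xs_def] by (auto simp: step_def split: action.splits)
  then show ?case by (simp add: xs_def)
qed simp

lemma chosen_box_in_opened:
  assumes "legal_rule n s"
  shows "chosen_box n s y \<in> set (opened n s y)"
  using legal_rule_stops(3)[OF assms, of y] by (auto simp: chosen_box_def)

lemma chosen_value_eq:
  assumes "legal_rule n s"
  shows "chosen_value n s y = y (chosen_box n s y)"
  using legal_rule_stops(3)[OF assms, of y] by (auto simp: chosen_box_def chosen_value_def)

text \<open>Non-anticipation: a rule reads \<open>y i\<close> only once box \<open>i\<close> is
  open. From then on the run is only extended at its end, so the part before \<open>i\<close> stays
  the same. All independence arguments rest on this.\<close>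

lemma iterated_step_fun_upd:
  fixes s :: decision_rule
  defines "it \<equiv> \<lambda>y k. (step s y ^^ k) []"
  shows "(i \<notin> set (it y k) \<longrightarrow> it (y(i := t)) k = it y k) \<and>
    (i \<in> set (it y k) \<longrightarrow> i \<in> set (it (y(i := t)) k) \<and>
      takeWhile (\<lambda>j. j \<noteq> i) (it (y(i := t)) k) = takeWhile (\<lambda>j. j \<noteq> i) (it y k))"
proof (induction k)
  case 0
  then show ?case by (simp add: it_def)
next
  case (Suc k)
  have Suc_it: "it y (Suc k) = step s y (it y k)" for y
    by (simp add: it_def)
  have step_append: "\<exists>zs. step s y xs = xs @ zs" for y xs
    by (auto simp: step_def split: action.splits)
  show ?case
  proof (cases "i \<in> set (it y k)")
    case False
    with Suc have "it (y(i := t)) k = it y k" by blast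
    moreover have "observed (y(i := t)) (it y k) = observed y (it y k)"
      using False by (intro observed_cong) auto
    ultimately have "it (y(i := t)) (Suc k) = it y (Suc k)"
      by (simp add: Suc_it step_def)
    then show ?thesis by (simp del: fun_upd_apply)
  next
    case True
    obtain zs zs' where "it y (Suc k) = it y k @ zs" "it (y(i := t)) (Suc k) = it (y(i := t)) k @ zs'"
      using step_append unfolding Suc_it by meson
    then show ?thesis using True Suc by (auto simp del: fun_upd_apply)
  qed
qed

lemma in_opened_fun_upd:
  "i \<in> set (opened n s (y(i := t))) \<longleftrightarrow> i \<in> set (opened n s y)"
proof
  note upd = iterated_step_fun_upd[where s = s and i = i and k = n]
  show "i \<in> set (opened n s (y(i := t))) \<Longrightarrow> i \<in> set (opened n s y)"
    using upd[of y t] unfolding opened_def by metis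
  show "i \<in> set (opened n s y) \<Longrightarrow> i \<in> set (opened n s (y(i := t)))"
    using upd[of y t] unfolding opened_def by blast
qed

lemma opened_before_fun_upd:
  assumes "i \<in> set (opened n s y)"
  shows "takeWhile (\<lambda>j. j \<noteq> i) (opened n s (y(i := t))) = takeWhile (\<lambda>j. j \<noteq> i) (opened n s y)"
  using iterated_step_fun_upd[where s = s and i = i and k = n and y = y and t = t] assms
  unfolding opened_def by blast

text \<open>One rule for both halves: with all boxes sorted by decreasing \<open>z\<close> it is the
  index rule, with constant \<open>z\<close> and an arbitrary list it yields the extremal behaviors.
  Histories that do not follow \<open>xs\<close> lead to stopping, so that the rule is legal at all
  of them; \<open>find\<close> fails only at the empty history.\<close>

definition list_rule :: "nat list \<Rightarrow> (nat \<Rightarrow> real) \<Rightarrow> decision_rule" where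
  "list_rule xs z h =
     (if length h < length xs \<and> map fst h = take (length h) xs \<and>
         (\<forall>(i, t)\<in>set h. t \<le> z (xs ! length h))
      then Open (xs ! length h)
      else Stop (fst (the (find (\<lambda>(i, t). \<forall>(j, t')\<in>set h. t' \<le> t) h))))"

lemma find_best:
  fixes h :: history
  assumes "h \<noteq> []"
  obtains i t where "find (\<lambda>(i, t). \<forall>(j, t')\<in>set h. t' \<le> t) h = Some (i, t)"
    "(i, t) \<in> set h" "\<forall>(j, t')\<in>set h. t' \<le> t"
proof -
  have fin: "finite (snd ` set h)" "snd ` set h \<noteq> {}" using assms by auto
  obtain x where "x \<in> set h" "snd x = Max (snd ` set h)"
    using Max_in[OF fin] by auto
  moreover have "t' \<le> Max (snd ` set h)" if "(j, t') \<in> set h" for j t'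
    using that fin by (intro Max_ge) force+
  ultimately have "\<exists>x\<in>set h. case x of (i, t) \<Rightarrow> \<forall>(j, t')\<in>set h. t' \<le> t"
    by (intro bexI[of _ x]) (auto split: prod.splits)
  then obtain x where x: "find (\<lambda>(i, t). \<forall>(j, t')\<in>set h. t' \<le> t) h = Some x"
    using find_None_iff[of "\<lambda>(i, t). \<forall>(j, t')\<in>set h. t' \<le> t" h] by fastforce
  obtain i t where it: "x = (i, t)" by fastforce
  from x have "x \<in> set h \<and> (case x of (i, t) \<Rightarrow> \<forall>(j, t')\<in>set h. t' \<le> t)"
    unfolding find_Some_iff by (metis (no_types) nth_mem)
  with x that[of i t] show thesis
    unfolding it by blast
qed

text \<open>Lists shorter than \<open>n\<close> encode stopping before all boxes are open; the empty
  list is excluded because at least one box has to be opened.\<close>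

definition valid_lists :: "nat \<Rightarrow> nat list set" where
  "valid_lists n = {xs. distinct xs \<and> set xs \<subseteq> {1..n} \<and> xs \<noteq> []}"

lemma finite_distinct_lists: "finite {xs. distinct xs \<and> set xs \<subseteq> {1..n::nat}}"
  using finite_subset_distinct[of "{1..n}"] by (simp add: conj_commute)

lemma finite_valid_lists: "finite (valid_lists n)"
  by (rule finite_subset[OF _ finite_distinct_lists[of n]]) (auto simp: valid_lists_def)

lemma legal_list_rule:
  assumes "xs \<in> valid_lists n"
  shows "legal_rule n (list_rule xs z)"
  unfolding legal_rule_def
proof (intro allI impI)
  fix h :: history
  assume h: "distinct (map fst h) \<and> fst ` set h \<subseteq> {1..n}"
  let ?k = "length h"
  show "case list_rule xs z h of Open i \<Rightarrow> i \<in> {1..n} - fst ` set h | Stop i \<Rightarrow> i \<in> fst ` set h"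
  proof (cases "?k < length xs \<and> map fst h = take ?k xs \<and> (\<forall>(i, t)\<in>set h. t \<le> z (xs ! ?k))")
    case True
    then have "fst ` set h = set (take ?k xs)" by (metis set_map)
    moreover have "xs ! ?k \<notin> set (take ?k xs)"
      using True assms by (auto simp: valid_lists_def in_set_conv_nth nth_eq_iff_index_eq)
    moreover have "xs ! ?k \<in> {1..n}"
      using True assms nth_mem[of ?k xs] unfolding valid_lists_def by blast
    ultimately show ?thesis using True by (simp add: list_rule_def)
  next
    case False
    have "h \<noteq> []" using False assms by (auto simp: valid_lists_def)
    then obtain i t where best: "find (\<lambda>(i, t). \<forall>(j, t')\<in>set h. t' \<le> t) h = Some (i, t)"
      "(i, t) \<in> set h"
      by (rule find_best)
    have "list_rule xs z h = Stop i"
      using False by (simp only: list_rule_def if_False best(1) option.sel fst_conv)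
    moreover have "i \<in> fst ` set h" using best(2) by force
    ultimately show ?thesis by simp
  qed
qed

text \<open>For a fixed order of opening, the choice becomes a search over box numbers whose tests
  are inequalities between coordinates of \<open>y\<close>, the form in which measurability can be
  checked.\<close>

lemma list_rule_observed:
  "list_rule xs z (observed y ys) =
     (if length ys < length xs \<and> ys = take (length ys) xs \<and> (\<forall>i\<in>set ys. y i \<le> z (xs ! length ys))
      then Open (xs ! length ys)
      else Stop (fst (the (map_option (\<lambda>i. (i, y i)) (find (\<lambda>i. \<forall>j\<in>set ys. y j \<le> y i) ys)))))"
proof -
  have "find Q (map f ys) = map_option f (find (Q \<circ> f) ys)" for Q and f :: "nat \<Rightarrow> nat \<times> real" and ys
    by (induction ys) auto
  then show ?thesis
    by (simp add: list_rule_def observed_def o_def)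
qed

lemma list_rule_take:
  assumes "m \<le> length xs"
  obtains i where "list_rule xs z (observed y (take m xs)) =
    (if m < length xs \<and> (\<forall>j<m. y (xs ! j) \<le> z (xs ! m)) then Open (xs ! m) else Stop i)"
proof -
  have "set (take m xs) = (!) xs ` {..<m}"
    using nth_image[OF assms] by (simp add: atLeast0LessThan)
  then have observed_le: "(\<forall>i\<in>set (take m xs). y i \<le> t) \<longleftrightarrow> (\<forall>j<m. y (xs ! j) \<le> t)" for t
    by (simp add: lessThan_def)
  have "\<exists>i. list_rule xs z (observed y (take m xs)) =
      (if m < length xs \<and> (\<forall>j<m. y (xs ! j) \<le> z (xs ! m)) then Open (xs ! m) else Stop i)"
    by (cases "m < length xs \<and> (\<forall>j<m. y (xs ! j) \<le> z (xs ! m))")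
      (auto simp: list_rule_observed observed_le min_absorb2 assms)
  with that show thesis by blast
qed

lemma opened_list_rule:
  assumes "xs \<in> valid_lists n"
  obtains m where "0 < m" "m \<le> length xs" "opened n (list_rule xs z) y = take m xs"
    "\<And>j l. j < l \<Longrightarrow> l < m \<Longrightarrow> y (xs ! j) \<le> z (xs ! l)"
    "m < length xs \<Longrightarrow> \<exists>j<m. z (xs ! m) < y (xs ! j)"
proof -
  let ?it = "\<lambda>k. (step (list_rule xs z) y ^^ k) []"
  \<comment> \<open>The last disjunct separates a run that has opened a box at every step,
    \<open>m = k\<close>, from one that has ended. At \<open>k = n\<close> the former also means
    that \<open>xs\<close> is exhausted, since it has at most \<open>n\<close> entries.\<close>
  have "\<exists>m\<le>length xs. ?it k = take m xs \<and> (\<forall>l<m. \<forall>j<l. y (xs ! j) \<le> z (xs ! l)) \<and>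
      (m = k \<or> m = length xs \<or> (\<exists>j<m. z (xs ! m) < y (xs ! j)))" for k
  proof (induction k)
    case (Suc k)
    then obtain m where m: "m \<le> length xs" "?it k = take m xs"
      "\<forall>l<m. \<forall>j<l. y (xs ! j) \<le> z (xs ! l)"
      "m = k \<or> m = length xs \<or> (\<exists>j<m. z (xs ! m) < y (xs ! j))" by blast
    obtain i where rule: "list_rule xs z (observed y (take m xs)) =
        (if m < length xs \<and> (\<forall>j<m. y (xs ! j) \<le> z (xs ! m)) then Open (xs ! m) else Stop i)"
      by (rule list_rule_take[OF m(1)])
    have Suc_it: "?it (Suc k) = step (list_rule xs z) y (take m xs)"
      using m(2) by simp
    show ?case
    proof (cases "m < length xs \<and> (\<forall>j<m. y (xs ! j) \<le> z (xs ! m))")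
      case True
      then have "?it (Suc k) = take (Suc m) xs"
        unfolding Suc_it step_def rule by (simp add: take_Suc_conv_app_nth)
      moreover have "m = k" using True m(4) by fastforce
      ultimately show ?thesis using True m(3) by (intro exI[of _ "Suc m"]) (auto simp: less_Suc_eq)
    next
      case False
      then have stop: "m = length xs \<or> (\<exists>j<m. z (xs ! m) < y (xs ! j))"
        using m(1) by force
      have "?it (Suc k) = take m xs"
        using False unfolding Suc_it step_def rule by simp
      then show ?thesis using m(1,3) stop by blast
    qed
  qed (simp add: exI[of _ 0])
  from this[of n] obtain m where m: "m \<le> length xs" "?it n = take m xs"
      "\<forall>l<m. \<forall>j<l. y (xs ! j) \<le> z (xs ! l)"
      "m = n \<or> m = length xs \<or> (\<exists>j<m. z (xs ! m) < y (xs ! j))" by blast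
  have "length xs = card (set xs)"
    using assms by (simp add: valid_lists_def distinct_card)
  also have "\<dots> \<le> n"
    using assms card_mono[of "{1..n}" "set xs"] by (simp add: valid_lists_def)
  finally have len: "length xs \<le> n" .
  have "opened n (list_rule xs z) y = take m xs" using m(2) by (simp add: opened_def)
  moreover from this have "0 < m"
    using legal_rule_stops(3)[OF legal_list_rule[OF assms], of z y] by (cases m) auto
  ultimately show thesis
    using that[of m] m len by auto
qed

lemma nth_in_opened_list_rule:
  assumes "xs \<in> valid_lists n" "k < length xs"
  shows "xs ! k \<in> set (opened n (list_rule xs z) y) \<longleftrightarrow>
    (\<forall>l\<le>k. \<forall>j<l. y (xs ! j) \<le> z (xs ! l))"
proof -
  obtain m where m: "m \<le> length xs" "opened n (list_rule xs z) y = take m xs"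
    "\<And>j l. j < l \<Longrightarrow> l < m \<Longrightarrow> y (xs ! j) \<le> z (xs ! l)"
    "m < length xs \<Longrightarrow> \<exists>j<m. z (xs ! m) < y (xs ! j)"
    using opened_list_rule[OF assms(1)] by metis
  have "xs ! k \<in> set (take m xs) \<longleftrightarrow> k < m"
    using assms m(1) by (auto simp: in_set_conv_nth valid_lists_def nth_eq_iff_index_eq)
  moreover have "k < m" if "\<forall>l\<le>k. \<forall>j<l. y (xs ! j) \<le> z (xs ! l)"
    using that m(4) assms(2) by (meson le_less_trans not_less)
  ultimately show ?thesis using m(2,3) by (metis le_less_trans)
qed

lemma opened_list_rule_subset:
  assumes "xs \<in> valid_lists n"
  shows "set (opened n (list_rule xs z) y) \<subseteq> set xs"
  using opened_list_rule[OF assms, of z y] by (metis set_take_subset)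

lemma chosen_box_list_rule:
  fixes y z :: "nat \<Rightarrow> real"
  assumes "xs \<in> valid_lists n"
  defines "B \<equiv> set (opened n (list_rule xs z) y)" and "i \<equiv> chosen_box n (list_rule xs z) y"
  shows "i \<in> B" "j \<in> B \<Longrightarrow> y j \<le> y i"
proof -
  let ?xs = "opened n (list_rule xs z) y"
  let ?h = "observed y ?xs"
  note stops = legal_rule_stops(3)[OF legal_list_rule[OF assms(1)], of z y]
  then have "?h \<noteq> []" by (auto simp: observed_def)
  then obtain k t where best: "find (\<lambda>(i, t). \<forall>(j, t')\<in>set ?h. t' \<le> t) ?h = Some (k, t)"
    "(k, t) \<in> set ?h" "\<forall>(j, t')\<in>set ?h. t' \<le> t"
    by (rule find_best)
  obtain i' where i': "list_rule xs z ?h = Stop i'" using stops by blast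
  then have "i' = k" using best(1) by (auto simp: list_rule_def split: if_splits)
  then have "i = k" using i' by (simp add: i_def chosen_box_def)
  then show "i \<in> B" "j \<in> B \<Longrightarrow> y j \<le> y i"
    using best(2,3) by (auto simp: set_observed B_def)
qed

text \<open>Both parts rest on one inequality: a value seen before a box is opened is at most the
  index of that box, and indices decrease weakly along the list. So an unchosen box opened before
  \<open>i\<close> has \<open>y j \<le> z i \<le> z j\<close>, and one opened after \<open>i\<close>
  has \<open>y j \<le> y i \<le> z j\<close>.\<close>

lemma list_rule_index:
  fixes y z :: "nat \<Rightarrow> real"
  assumes xs: "xs \<in> valid_lists n" "sorted_wrt (\<lambda>i j. z j \<le> z i) xs"
  defines "B \<equiv> set (opened n (list_rule xs z) y)" and "i \<equiv> chosen_box n (list_rule xs z) y"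
  shows "j \<in> B \<Longrightarrow> j \<noteq> i \<Longrightarrow> y j \<le> z j"
    and "j \<in> set xs \<Longrightarrow> min (y j) (z j) \<le> min (y i) (z i)"
proof -
  obtain m where m: "0 < m" "m \<le> length xs" "opened n (list_rule xs z) y = take m xs"
    "\<And>j l. j < l \<Longrightarrow> l < m \<Longrightarrow> y (xs ! j) \<le> z (xs ! l)"
    "m < length xs \<Longrightarrow> \<exists>j<m. z (xs ! m) < y (xs ! j)"
    using opened_list_rule[OF xs(1)] by metis
  have B: "B = (\<lambda>j. xs ! j) ` {..<m}"
    using nth_image[OF m(2)] m(3) by (simp add: B_def atLeast0LessThan)
  note best = chosen_box_list_rule[where z = z and y = y, OF xs(1), folded B_def i_def]
  obtain a where a: "a < m" "i = xs ! a" using best(1) B by auto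
  have sorted: "z (xs ! l) \<le> z (xs ! k)" if "k \<le> l" "l < length xs" for k l
    using that xs(2) by (cases "k = l") (auto simp: sorted_wrt_iff_nth_less)
  have best_le: "y (xs ! b) \<le> y i" if "b < m" for b
    using best(2) B that by auto
  show exposed: "y j \<le> z j" if j: "j \<in> B" "j \<noteq> i"
  proof -
    obtain b where b: "b < m" "j = xs ! b" using j B by auto
    consider "b < a" | "a < b" using j b a by (metis linorder_neqE_nat)
    then show ?thesis
    proof cases
      case 1
      then have "y j \<le> z (xs ! a)" using m(4) a b by simp
      also have "\<dots> \<le> z j" using sorted[of b a] 1 a b m(2) by simp
      finally show ?thesis .
    next
      case 2
      then show ?thesis using m(4)[of a b] best_le[of b] a b by simp
    qed
  qed
  show "min (y j) (z j) \<le> min (y i) (z i)" if "j \<in> set xs"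
  proof -
    obtain b where b: "b < length xs" "j = xs ! b" using \<open>j \<in> set xs\<close> by (auto simp: in_set_conv_nth)
    show ?thesis
    proof (cases "b < m")
      \<comment> \<open>\<open>xs ! m\<close> is the first unopened box, and the value that ended
        the search exceeds its index. Hence \<open>z j\<close> lies below both \<open>y i\<close>
        and \<open>z i\<close>.\<close>
      case False
      then obtain l where l: "l < m" "z (xs ! m) < y (xs ! l)" using m(5) b by auto
      have "z j \<le> z (xs ! m)" using sorted[of m b] False b by simp
      moreover have "z (xs ! m) \<le> z i" using sorted[of a m] a False b by simp
      ultimately show ?thesis using l best_le[OF l(1)] by linarith
    next
      case True
      then have le: "y j \<le> y i" using best_le b by simp
      consider "b < a" | "b = a" | "a < b" by linarith
      then show ?thesis
      proof cases
        case 1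
        then have "y j \<le> z i" using m(4) a b by simp
        then show ?thesis using le by linarith
      next
        case 2
        then show ?thesis using a b by simp
      next
        case 3
        then have "y i \<le> z (xs ! b)" using m(4)[of a b] a b True by simp
        moreover have "z (xs ! b) \<le> z i" using sorted[of a b] 3 a b by simp
        ultimately show ?thesis using le by simp
      qed
    qed
  qed
qed

section \<open>Expected payoffs\<close>

lemma measurable_count_space_find:
  assumes "\<And>x. x \<in> set xs \<Longrightarrow> Measurable.pred M (\<lambda>\<omega>. P \<omega> x)"
  shows "(\<lambda>\<omega>. find (P \<omega>) xs) \<in> M \<rightarrow>\<^sub>M count_space UNIV"
  using assms
proof (induction xs)
  case (Cons x xs)
  then have [measurable]: "Measurable.pred M (\<lambda>\<omega>. P \<omega> x)"
    "(\<lambda>\<omega>. find (P \<omega>) xs) \<in> M \<rightarrow>\<^sub>M count_space UNIV" by auto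
  show ?case by simp
qed simp

lemma measurable_list_rule:
  assumes "set ys \<subseteq> {1..n}"
  shows "(\<lambda>y. list_rule xs z (observed y ys)) \<in> PiM {1..n} (\<lambda>_. borel) \<rightarrow>\<^sub>M count_space UNIV"
proof -
  have coord: "(\<lambda>y. y i :: real) \<in> borel_measurable (PiM {1..n} (\<lambda>_. borel))" if "i \<in> set ys" for i
    using assms that by (intro measurable_component_singleton) auto
  have le: "Measurable.pred (PiM {1..n} (\<lambda>_. borel :: real measure)) (\<lambda>y. y j \<le> y i)"
    if "i \<in> set ys" "j \<in> set ys" for i j
    unfolding pred_def by (intro borel_measurable_le coord that)
  have [measurable]: "Measurable.pred (PiM {1..n} (\<lambda>_. borel :: real measure))
      (\<lambda>y. \<forall>i\<in>set ys. y i \<le> c)" for c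
  proof (intro pred_intros_finite finite_set)
    show "Measurable.pred (PiM {1..n} (\<lambda>_. borel :: real measure)) (\<lambda>y. y i \<le> c)" if "i \<in> set ys" for i
      unfolding pred_def by (intro borel_measurable_le coord that) simp
  qed
  let ?best = "\<lambda>y :: nat \<Rightarrow> real. find (\<lambda>i. \<forall>j\<in>set ys. y j \<le> y i) ys"
  have best: "?best \<in> PiM {1..n} (\<lambda>_. borel) \<rightarrow>\<^sub>M count_space UNIV"
    by (intro measurable_count_space_find pred_intros_finite finite_set le)
  \<comment> \<open>The \<open>None\<close> branch reproduces the unspecified action at an empty
    list, so that the action is a function of \<open>?best y\<close> alone.\<close>
  define stop where "stop r = (case r of None \<Rightarrow> Stop (fst (the (None :: (nat \<times> real) option))) | Some i \<Rightarrow> Stop i)"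
    for r
  have stop: "Stop (fst (the (map_option (\<lambda>i. (i, y i)) (?best y)))) = stop (?best y)" for y
    by (auto simp: stop_def split: option.split)
  have [measurable]: "(\<lambda>y. stop (?best y)) \<in> PiM {1..n} (\<lambda>_. borel) \<rightarrow>\<^sub>M count_space UNIV"
    by (rule measurable_compose[OF best, where g = stop]) simp
  show ?thesis
    unfolding list_rule_observed stop by measurable
qed

lemma is_strategy_list_rule:
  assumes X: "X \<in> borel \<rightarrow>\<^sub>M count_space UNIV" "\<And>u. X u \<in> valid_lists n"
  shows "is_strategy n (\<lambda>u. list_rule (X u) z)"
  unfolding is_strategy_def
proof safe
  fix ys assume ys: "set ys \<subseteq> {1..n}"
  let ?M = "borel \<Otimes>\<^sub>M PiM {1..n} (\<lambda>_. borel :: real measure)"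
  have "(\<lambda>\<omega>. list_rule (X (fst \<omega>)) z (observed (snd \<omega>) ys)) \<in> ?M \<rightarrow>\<^sub>M count_space UNIV"
  proof (rule measurable_compose_countable'[where I = UNIV and g = "\<lambda>\<omega>. X (fst \<omega>)"
        and f = "\<lambda>xs \<omega>. list_rule xs z (observed (snd \<omega>) ys)"])
    show "(\<lambda>\<omega>. list_rule xs z (observed (snd \<omega>) ys)) \<in> ?M \<rightarrow>\<^sub>M count_space UNIV" for xs
      by (rule measurable_compose[OF measurable_snd measurable_list_rule[OF ys]])
    show "(\<lambda>\<omega>. X (fst \<omega>)) \<in> ?M \<rightarrow>\<^sub>M count_space UNIV"
      using X(1) by measurable
  qed auto
  then show "(\<lambda>(u, y). list_rule (X u) z (observed y ys)) \<in> ?M \<rightarrow>\<^sub>M count_space UNIV"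
    by (simp add: case_prod_beta)
qed (use X(2) legal_list_rule in blast)

text \<open>All that is kept of a box is an integrable value and a solution \<open>z i\<close> of
  the reservation equation. Probability measures are required at every index because
  \<open>product_prob_space\<close> asks for them; \<open>feasible_search_behavior_necessary\<close>
  pads the family accordingly.\<close>

locale pandora_search =
  fixes n :: nat and \<gamma> :: "nat \<Rightarrow> box" and F :: "nat \<Rightarrow> real measure" and z :: "nat \<Rightarrow> real"
  assumes boxes: "0 < n"
    and real_distribution: "\<And>i. real_distribution (F i)"
    and integrable_value: "\<And>i. i \<in> {1..n} \<Longrightarrow> integrable (F i) (\<lambda>t. t)"
    and reservation: "\<And>i. i \<in> {1..n} \<Longrightarrow> (\<integral>t. max 0 (t - z i) \<partial>F i) = cost (\<gamma> i)"
begin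

lemma prob_space_F: "prob_space (F i)"
  using real_distribution[of i] by (simp add: real_distribution_def)

lemma sets_F [simp, measurable_cong]: "sets (F i) = sets borel"
  using real_distribution[of i] by (simp add: real_distribution_def real_distribution_axioms_def)

lemma space_F [simp]: "space (F i) = UNIV"
  using sets_eq_imp_space_eq[OF sets_F] by simp

end

sublocale pandora_search \<subseteq> product_prob_space F "{1..n}"
  by (intro product_prob_spaceI prob_space_F)

section \<open>Independence of an event from a single value\<close>

context pandora_search
begin

abbreviation J :: "(real \<times> (nat \<Rightarrow> real)) measure" where
  "J \<equiv> joint_law n F"

lemma sets_J: "sets J = sets (borel \<Otimes>\<^sub>M PiM {1..n} (\<lambda>_. borel))"
  unfolding joint_law_def by (intro sets_pair_measure_cong sets_PiM_cong) auto

lemma space_J: "space J = UNIV \<times> space (PiM {1..n} F)"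
  by (simp add: joint_law_def space_pair_measure)

lemma prob_space_uniform: "prob_space (uniform_measure lborel {0..1::real})"
  by (rule prob_space_uniform_measure) auto

sublocale J: prob_space J
  unfolding joint_law_def
  by (intro prob_space_pair prob_space_uniform P.prob_space_axioms)

lemma measurable_J: "measurable J N = measurable (borel \<Otimes>\<^sub>M PiM {1..n} (\<lambda>_. borel)) N"
  by (rule measurable_cong_sets[OF sets_J refl])

lemma measurable_value [measurable]:
  "i \<in> {1..n} \<Longrightarrow> (\<lambda>\<omega>. snd \<omega> i) \<in> borel_measurable J"
  unfolding measurable_J
  by (rule measurable_compose[OF measurable_snd measurable_component_singleton])

text \<open>Fubini with coordinate \<open>i\<close> innermost: there the indicator of
  \<open>E\<close> is constant and can be pulled out. Expressing independence by invariance under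
  \<open>y(i := t)\<close> fits what is known about runs and avoids the sigma-algebra of the other
  coordinates.\<close>

lemma nn_integral_independent:
  assumes i: "i \<in> {1..n}" and E: "E \<in> sets J" and g: "g \<in> borel_measurable borel"
    and invariant: "\<And>u y t. (u, y) \<in> space J \<Longrightarrow> (u, y(i := t)) \<in> E \<longleftrightarrow> (u, y) \<in> E"
  shows "(\<integral>\<^sup>+\<omega>. indicator E \<omega> * g (snd \<omega> i) \<partial>J) = emeasure J E * (\<integral>\<^sup>+t. g t \<partial>F i)"
proof -
  let ?H = "\<integral>\<^sup>+t. g t \<partial>F i" and ?I = "{1..n} - {i}"
  have insert_i: "insert i ?I = {1..n}" using i by auto
  have decompose: "(\<integral>\<^sup>+\<omega>. f \<omega> \<partial>J) = (\<integral>\<^sup>+u. \<integral>\<^sup>+x. \<integral>\<^sup>+t. f (u, x(i := t)) \<partial>F i \<partial>PiM ?I F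
      \<partial>uniform_measure lborel {0..1})" if f: "f \<in> borel_measurable J" for f
  proof -
    have [measurable]: "f \<in> borel_measurable (uniform_measure lborel {0..1} \<Otimes>\<^sub>M PiM {1..n} F)"
      using f by (simp add: joint_law_def)
    have "(\<integral>\<^sup>+\<omega>. f \<omega> \<partial>J) = (\<integral>\<^sup>+u. \<integral>\<^sup>+y. f (u, y) \<partial>PiM {1..n} F \<partial>uniform_measure lborel {0..1})"
      unfolding joint_law_def by (rule P.nn_integral_fst[symmetric]) measurable
    also have "\<dots> = (\<integral>\<^sup>+u. \<integral>\<^sup>+x. \<integral>\<^sup>+t. f (u, x(i := t)) \<partial>F i \<partial>PiM ?I F
      \<partial>uniform_measure lborel {0..1})"
    proof (rule nn_integral_cong)
      fix u :: real
      have "(\<lambda>y. f (u, y)) \<in> borel_measurable (PiM (insert i ?I) F)"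
        unfolding insert_i by measurable
      from product_nn_integral_insert[OF _ _ this]
      show "(\<integral>\<^sup>+y. f (u, y) \<partial>PiM {1..n} F) = (\<integral>\<^sup>+x. \<integral>\<^sup>+t. f (u, x(i := t)) \<partial>F i \<partial>PiM ?I F)"
        unfolding insert_i by simp
    qed
    finally show ?thesis .
  qed
  have [measurable]: "E \<in> sets J" "g \<in> borel_measurable borel" by fact+
  have "(\<integral>\<^sup>+\<omega>. indicator E \<omega> * g (snd \<omega> i) \<partial>J) =
      (\<integral>\<^sup>+u. \<integral>\<^sup>+x. \<integral>\<^sup>+t. indicator E (u, x(i := t)) * g t \<partial>F i \<partial>PiM ?I F
        \<partial>uniform_measure lborel {0..1})"
    using i by (subst decompose) simp_all
  also have "\<dots> = (\<integral>\<^sup>+u. \<integral>\<^sup>+x. \<integral>\<^sup>+t. indicator E (u, x(i := t)) * ?H \<partial>F i \<partial>PiM ?I F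
        \<partial>uniform_measure lborel {0..1})"
  proof (rule nn_integral_cong, rule nn_integral_cong)
    fix u :: real and x assume x: "x \<in> space (PiM ?I F)"
    \<comment> \<open>\<open>x\<close> has no coordinate \<open>i\<close>; 0 is an arbitrary filler
      that provides a reference point for the invariance.\<close>
    have "x(i := 0) \<in> space (PiM {1..n} F)"
      using x i by (auto simp: space_PiM PiE_def extensional_def)
    then have "(u, x(i := 0)) \<in> space J" by (simp add: space_J)
    from invariant[OF this] have inv: "(u, x(i := t)) \<in> E \<longleftrightarrow> (u, x(i := 0)) \<in> E" for t
      by simp
    define b :: ennreal where "b = indicator E (u, x(i := 0))"
    have const: "indicator E (u, x(i := t)) = b" for t
      using inv[of t] by (simp add: indicator_def b_def)
    have "b = 0 \<or> b = 1" by (simp add: b_def indicator_def)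
    then show "(\<integral>\<^sup>+t. indicator E (u, x(i := t)) * g t \<partial>F i) =
        (\<integral>\<^sup>+t. indicator E (u, x(i := t)) * ?H \<partial>F i)"
      unfolding const using prob_space.emeasure_space_1[OF prob_space_F, of i] by auto
  qed
  also have "\<dots> = (\<integral>\<^sup>+\<omega>. indicator E \<omega> * ?H \<partial>J)"
    by (subst decompose) simp_all
  also have "\<dots> = emeasure J E * ?H"
    by (simp add: nn_integral_multc)
  finally show ?thesis .
qed

lemma sets_restrict_value:
  assumes "i \<in> {1..n}" "E \<in> sets J" "A \<in> sets borel"
  shows "{\<omega>\<in>E. snd \<omega> i \<in> A} \<in> sets J"
proof -
  have "{\<omega>\<in>E. snd \<omega> i \<in> A} = E \<inter> ((\<lambda>\<omega>. snd \<omega> i) -` A \<inter> space J)"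
    using sets.sets_into_space[OF assms(2)] by auto
  then show ?thesis
    using assms(2) measurable_sets[OF measurable_value[OF assms(1)] assms(3)] by auto
qed

lemma prob_independent:
  assumes "i \<in> {1..n}" "E \<in> sets J" "A \<in> sets borel"
    and "\<And>u y t. (u, y) \<in> space J \<Longrightarrow> (u, y(i := t)) \<in> E \<longleftrightarrow> (u, y) \<in> E"
  shows "J.prob {\<omega>\<in>E. snd \<omega> i \<in> A} = J.prob E * measure (F i) A"
proof -
  have [measurable]: "{\<omega>\<in>E. snd \<omega> i \<in> A} \<in> sets J"
    by (rule sets_restrict_value[OF assms(1-3)])
  have "(\<integral>\<^sup>+\<omega>. indicator {\<omega>\<in>E. snd \<omega> i \<in> A} \<omega> \<partial>J) =
      (\<integral>\<^sup>+\<omega>. indicator E \<omega> * indicator A (snd \<omega> i) \<partial>J)"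
    by (intro nn_integral_cong) (auto split: split_indicator)
  then have "emeasure J {\<omega>\<in>E. snd \<omega> i \<in> A} = (\<integral>\<^sup>+\<omega>. indicator E \<omega> * indicator A (snd \<omega> i) \<partial>J)"
    by simp
  also have "\<dots> = emeasure J E * emeasure (F i) A"
    using assms by (subst nn_integral_independent) auto
  finally show ?thesis
    by (simp add: measure_def enn2real_mult)
qed

lemma nn_integral_value:
  assumes "i \<in> {1..n}" "g \<in> borel_measurable borel"
  shows "(\<integral>\<^sup>+\<omega>. g (snd \<omega> i) \<partial>J) = (\<integral>\<^sup>+t. g t \<partial>F i)"
proof -
  have "(u, y(i := t)) \<in> space J" if "(u, y) \<in> space J" for u t and y :: "nat \<Rightarrow> real"
    using that assms(1) by (auto simp: space_J space_PiM PiE_def extensional_def)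
  then have "(\<integral>\<^sup>+\<omega>. indicator (space J) \<omega> * g (snd \<omega> i) \<partial>J) = (\<integral>\<^sup>+t. g t \<partial>F i)"
    using assms by (subst nn_integral_independent) (auto simp: J.emeasure_space_1)
  moreover have "(\<integral>\<^sup>+\<omega>. indicator (space J) \<omega> * g (snd \<omega> i) \<partial>J) = (\<integral>\<^sup>+\<omega>. g (snd \<omega> i) \<partial>J)"
    by (intro nn_integral_cong) auto
  ultimately show ?thesis by simp
qed

lemma integrable_function_of_value:
  fixes g :: "real \<Rightarrow> real"
  assumes "i \<in> {1..n}" "g \<in> borel_measurable borel" "integrable (F i) g"
  shows "integrable J (\<lambda>\<omega>. g (snd \<omega> i))"
proof (rule integrableI_bounded)
  show "(\<lambda>\<omega>. g (snd \<omega> i)) \<in> borel_measurable J"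
    by (rule measurable_compose[OF measurable_value[OF assms(1)] assms(2)])
  have [measurable]: "g \<in> borel_measurable borel" by fact
  have "(\<integral>\<^sup>+\<omega>. ennreal (norm (g (snd \<omega> i))) \<partial>J) = (\<integral>\<^sup>+t. ennreal (norm (g t)) \<partial>F i)"
    by (rule nn_integral_value[OF assms(1)]) measurable
  then show "(\<integral>\<^sup>+\<omega>. ennreal (norm (g (snd \<omega> i))) \<partial>J) < \<infinity>"
    using assms(3) by (simp add: integrable_iff_bounded)
qed

lemma AE_value:
  assumes "i \<in> {1..n}" "A \<in> sets borel" "AE t in F i. t \<in> A"
  shows "AE \<omega> in J. snd \<omega> i \<in> A"
proof -
  have [measurable]: "A \<in> sets borel" by fact
  have "(\<integral>\<^sup>+\<omega>. indicator (- A) (snd \<omega> i) \<partial>J) = (\<integral>\<^sup>+t. indicator (- A) t \<partial>F i)"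
    by (rule nn_integral_value[OF assms(1)]) measurable
  also have "\<dots> = 0"
    using assms(3) by (subst nn_integral_0_iff_AE) (auto simp: indicator_def)
  finally have "AE \<omega> in J. (indicator (- A) (snd \<omega> i) :: ennreal) = 0"
    using assms(1) by (subst (asm) nn_integral_0_iff_AE) simp_all
  then show ?thesis by eventually_elim (auto simp: indicator_def split: if_splits)
qed

lemma integrable_index_terms:
  assumes "i \<in> {1..n}"
  shows "integrable (F i) (\<lambda>t. max 0 (t - z i))" "integrable (F i) (\<lambda>t. min t (z i))"
proof -
  have "integrable (F i) (\<lambda>t. t - z i)" "integrable (F i) (\<lambda>t. t)"
    using integrable_value[OF assms] by auto
  then show "integrable (F i) (\<lambda>t. max 0 (t - z i))" "integrable (F i) (\<lambda>t. min t (z i))"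
    by (auto intro!: integrable_max integrable_min)
qed

lemma integral_excess:
  assumes i: "i \<in> {1..n}" and E: "E \<in> sets J"
    and invariant: "\<And>u y t. (u, y) \<in> space J \<Longrightarrow> (u, y(i := t)) \<in> E \<longleftrightarrow> (u, y) \<in> E"
  shows "(\<integral>\<omega>. indicator E \<omega> * max 0 (snd \<omega> i - z i) \<partial>J) = J.prob E * cost (\<gamma> i)"
proof -
  have [measurable]: "E \<in> sets J" by fact
  have "(\<integral>\<omega>. indicator E \<omega> * max 0 (snd \<omega> i - z i) \<partial>J) =
      enn2real (\<integral>\<^sup>+\<omega>. ennreal (indicator E \<omega> * max 0 (snd \<omega> i - z i)) \<partial>J)"
    using i by (intro integral_eq_nn_integral) (auto simp: indicator_def)
  also have "(\<integral>\<^sup>+\<omega>. ennreal (indicator E \<omega> * max 0 (snd \<omega> i - z i)) \<partial>J) =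
      (\<integral>\<^sup>+\<omega>. indicator E \<omega> * ennreal (max 0 (snd \<omega> i - z i)) \<partial>J)"
    by (intro nn_integral_cong) (auto simp: indicator_def)
  also have "\<dots> = emeasure J E * (\<integral>\<^sup>+t. ennreal (max 0 (t - z i)) \<partial>F i)"
    by (rule nn_integral_independent[OF i E _ invariant]) measurable
  also have "(\<integral>\<^sup>+t. ennreal (max 0 (t - z i)) \<partial>F i) = ennreal (cost (\<gamma> i))"
    using integrable_index_terms[OF i] by (subst nn_integral_eq_integral) (auto simp: reservation[OF i])
  finally show ?thesis
    using reservation[OF i, symmetric] by (simp add: measure_def enn2real_mult)
qed

section \<open>Measurability of the run of a strategy\<close>

abbreviation opened_list :: "strategy \<Rightarrow> real \<times> (nat \<Rightarrow> real) \<Rightarrow> nat list" where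
  "opened_list \<sigma> \<omega> \<equiv> opened n (\<sigma> (fst \<omega>)) (snd \<omega>)"

abbreviation chosen :: "strategy \<Rightarrow> real \<times> (nat \<Rightarrow> real) \<Rightarrow> nat" where
  "chosen \<sigma> \<omega> \<equiv> chosen_box n (\<sigma> (fst \<omega>)) (snd \<omega>)"

lemma measurable_strategy:
  assumes "is_strategy n \<sigma>" "distinct xs" "set xs \<subseteq> {1..n}"
  shows "(\<lambda>\<omega>. \<sigma> (fst \<omega>) (observed (snd \<omega>) xs)) \<in> J \<rightarrow>\<^sub>M count_space UNIV"
proof -
  have "(\<lambda>(u, y). \<sigma> u (observed y xs)) \<in> borel \<Otimes>\<^sub>M PiM {1..n} (\<lambda>_. borel) \<rightarrow>\<^sub>M count_space UNIV"
    using assms unfolding is_strategy_def by blast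
  then show ?thesis
    unfolding measurable_J case_prod_unfold .
qed

lemma strategy_legal: "is_strategy n \<sigma> \<Longrightarrow> legal_rule n (\<sigma> u)"
  by (simp add: is_strategy_def)

text \<open>\<open>is_strategy\<close> grants measurability only at lists of distinct boxes from
  \<open>{1..n}\<close>, so the induction carries this range along; as it is finite, the next step
  can be treated with the current list fixed.\<close>

lemma measurable_opened_list_aux:
  assumes \<sigma>: "is_strategy n \<sigma>"
  shows "(\<lambda>\<omega>. opened_list \<sigma> \<omega>) \<in> J \<rightarrow>\<^sub>M count_space {xs. distinct xs \<and> set xs \<subseteq> {1..n}}"
proof -
  let ?L = "{xs. distinct xs \<and> set xs \<subseteq> {1..n}}"
  have countable: "countable ?L"
    by (rule countable_finite[OF finite_distinct_lists])
  have "(\<lambda>\<omega>. (step (\<sigma> (fst \<omega>)) (snd \<omega>) ^^ k) []) \<in> J \<rightarrow>\<^sub>M count_space ?L" for k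
  proof (induction k)
    case (Suc k)
    have "(\<lambda>\<omega>. step (\<sigma> (fst \<omega>)) (snd \<omega>) xs) \<in> J \<rightarrow>\<^sub>M count_space UNIV" if "xs \<in> ?L" for xs
      unfolding step_def
      by (rule measurable_compose[OF measurable_strategy[OF \<sigma>],
            where g = "\<lambda>a. case a of Open i \<Rightarrow> xs @ [i] | Stop _ \<Rightarrow> xs"]) (use that in auto)
    then have "(\<lambda>\<omega>. step (\<sigma> (fst \<omega>)) (snd \<omega>) ((step (\<sigma> (fst \<omega>)) (snd \<omega>) ^^ k) []))
        \<in> J \<rightarrow>\<^sub>M count_space UNIV"
      by (rule measurable_compose_countable'[OF _ Suc countable])
    then have "(\<lambda>\<omega>. (step (\<sigma> (fst \<omega>)) (snd \<omega>) ^^ Suc k) []) \<in> J \<rightarrow>\<^sub>M count_space UNIV"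
      by simp
    then show ?case
      using iterated_step[OF strategy_legal[OF \<sigma>], where k = "Suc k"]
      by (subst measurable_count_space_eq2_countable) (auto simp: countable simp del: funpow.simps intro: measurable_sets)
  qed simp
  then show ?thesis by (simp add: opened_def)
qed

lemma measurable_opened_list:
  assumes "is_strategy n \<sigma>"
  shows "(\<lambda>\<omega>. opened_list \<sigma> \<omega>) \<in> J \<rightarrow>\<^sub>M count_space UNIV"
  using measurable_compose[OF measurable_opened_list_aux[OF assms], of "\<lambda>xs. xs" "count_space UNIV"]
  by simp

lemma measurable_chosen:
  assumes \<sigma>: "is_strategy n \<sigma>"
  shows "(\<lambda>\<omega>. chosen \<sigma> \<omega>) \<in> J \<rightarrow>\<^sub>M count_space UNIV"
  unfolding chosen_box_def
proof (rule measurable_compose_countable'[OF _ measurable_opened_list_aux[OF \<sigma>]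
      countable_finite[OF finite_distinct_lists]])
  fix xs :: "nat list" assume "xs \<in> {xs. distinct xs \<and> set xs \<subseteq> {1..n}}"
  then show "(\<lambda>\<omega>. case \<sigma> (fst \<omega>) (observed (snd \<omega>) xs) of Open i \<Rightarrow> 0 | Stop i \<Rightarrow> i)
      \<in> J \<rightarrow>\<^sub>M count_space UNIV"
    by (intro measurable_compose[OF measurable_strategy[OF \<sigma>],
          where g = "\<lambda>a. case a of Open i \<Rightarrow> 0 | Stop i \<Rightarrow> i"]) auto
qed

lemma pred_opened_list:
  assumes "is_strategy n \<sigma>"
  shows "{\<omega>\<in>space J. P (opened_list \<sigma> \<omega>)} \<in> sets J"
  using measurable_sets[OF measurable_opened_list[OF assms], of "Collect P"]
  by (simp add: vimage_def Collect_conj_eq Int_commute)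

text \<open>The amortized payoff: once the excess over \<open>z i\<close> is charged in place of the
  cost, the chosen box earns its capped value and any other opened box loses its excess. It is
  written with one term per box so that integrability and the comparison with \<open>payoff\<close>
  can be checked box by box.\<close>

definition surplus :: "strategy \<Rightarrow> real \<times> (nat \<Rightarrow> real) \<Rightarrow> real" where
  "surplus \<sigma> \<omega> = (\<Sum>i\<in>{1..n}.
     of_bool (chosen \<sigma> \<omega> = i) * min (snd \<omega> i) (z i) -
     of_bool (i \<in> set (opened_list \<sigma> \<omega>) \<and> chosen \<sigma> \<omega> \<noteq> i) * max 0 (snd \<omega> i - z i))"

lemma surplus_eq:
  assumes "is_strategy n \<sigma>"
  shows "surplus \<sigma> \<omega> = min (snd \<omega> (chosen \<sigma> \<omega>)) (z (chosen \<sigma> \<omega>)) -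
    (\<Sum>i\<in>{1..n}. of_bool (i \<in> set (opened_list \<sigma> \<omega>) \<and> chosen \<sigma> \<omega> \<noteq> i) * max 0 (snd \<omega> i - z i))"
proof -
  have "chosen \<sigma> \<omega> \<in> {1..n}"
    using chosen_box_in_opened legal_rule_stops(2) strategy_legal[OF assms] by blast
  then show ?thesis
    by (simp add: surplus_def sum_subtractf of_bool_def if_distrib[of "\<lambda>x. x * _"] cong: if_cong)
qed

lemma integrable_surplus:
  assumes "is_strategy n \<sigma>"
  shows "integrable J (surplus \<sigma>)"
proof -
  have [measurable]: "(\<lambda>\<omega>. opened_list \<sigma> \<omega>) \<in> J \<rightarrow>\<^sub>M count_space UNIV"
    "(\<lambda>\<omega>. chosen \<sigma> \<omega>) \<in> J \<rightarrow>\<^sub>M count_space UNIV"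
    by (rule measurable_opened_list[OF assms] measurable_chosen[OF assms])+
  have bounded: "integrable J (\<lambda>\<omega>. of_bool (P \<omega>) * f \<omega>)"
    if "integrable J f" "Measurable.pred J P" for P and f :: "_ \<Rightarrow> real"
  proof (rule Bochner_Integration.integrable_bound[OF that(1)])
    show "(\<lambda>\<omega>. of_bool (P \<omega>) * f \<omega>) \<in> borel_measurable J"
      using that(2) borel_measurable_integrable[OF that(1)] by measurable
  qed simp
  have "integrable J (\<lambda>\<omega>. max 0 (snd \<omega> i - z i))" "integrable J (\<lambda>\<omega>. min (snd \<omega> i) (z i))"
    if "i \<in> {1..n}" for i
    using integrable_index_terms[OF that]
    by (intro integrable_function_of_value[OF that, where g = "\<lambda>t. max 0 (t - z i)"]
        integrable_function_of_value[OF that, where g = "\<lambda>t. min t (z i)"]; simp)+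
  then show ?thesis
    unfolding surplus_def
    by (intro Bochner_Integration.integrable_sum Bochner_Integration.integrable_diff bounded) measurable
qed

text \<open>The cost of an opened box equals the conditional expectation of the excess of its value over
  the reservation value, because the decision to open it is independent of that value.\<close>

lemma expected_payoff_eq_surplus:
  assumes \<sigma>: "is_strategy n \<sigma>"
  shows "expected_payoff n \<gamma> F \<sigma> = (\<integral>\<omega>. surplus \<sigma> \<omega> \<partial>J)"
proof -
  define E where "E i = {\<omega>\<in>space J. i \<in> set (opened_list \<sigma> \<omega>)}" for i
  have E: "E i \<in> sets J" for i
    unfolding E_def by (rule pred_opened_list[OF \<sigma>])
  have invariant: "(u, y(i := t)) \<in> E i \<longleftrightarrow> (u, y) \<in> E i"
    if "(u, y) \<in> space J" "i \<in> {1..n}" for u y i t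
    using that by (auto simp: E_def in_opened_fun_upd space_J space_PiM PiE_def extensional_def)
  have exc: "integrable J (\<lambda>\<omega>. max 0 (snd \<omega> i - z i))" if "i \<in> {1..n}" for i
    using integrable_index_terms[OF that]
    by (intro integrable_function_of_value[OF that, where g = "\<lambda>t. max 0 (t - z i)"]) auto
  have exc_E: "integrable J (\<lambda>\<omega>. indicator (E i) \<omega> * max 0 (snd \<omega> i - z i))"
    "integrable J (\<lambda>\<omega>. indicator (E i) \<omega> * cost (\<gamma> i))" if "i \<in> {1..n}" for i
    using integrable_mult_indicator[OF E exc[OF that]] E by (auto simp: J.emeasure_finite less_top[symmetric])
  have "payoff n \<gamma> (\<sigma> (fst \<omega>)) (snd \<omega>) = surplus \<sigma> \<omega> +
      (\<Sum>i\<in>{1..n}. indicator (E i) \<omega> * max 0 (snd \<omega> i - z i) - indicator (E i) \<omega> * cost (\<gamma> i))"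
    if \<omega>: "\<omega> \<in> space J" for \<omega>
  proof -
    let ?O = "set (opened_list \<sigma> \<omega>)" and ?i = "chosen \<sigma> \<omega>"
    have i: "?i \<in> ?O" and sub: "?O \<subseteq> {1..n}"
      using chosen_box_in_opened legal_rule_stops(2) strategy_legal[OF \<sigma>] by blast+
    have "payoff n \<gamma> (\<sigma> (fst \<omega>)) (snd \<omega>) = snd \<omega> ?i - (\<Sum>i\<in>?O. cost (\<gamma> i))"
      by (simp add: payoff_def chosen_value_eq[OF strategy_legal[OF \<sigma>]])
    also have "snd \<omega> ?i = (\<Sum>i\<in>{1..n}. of_bool (?i = i) * snd \<omega> i)"
      using i sub by (simp add: of_bool_def if_distrib[of "\<lambda>x. x * _"] subset_iff cong: if_cong)
    also have "(\<Sum>i\<in>?O. cost (\<gamma> i)) = (\<Sum>i\<in>{1..n}. indicator (E i) \<omega> * cost (\<gamma> i))"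
      using \<omega> sub by (intro sum.mono_neutral_cong_left) (auto simp: E_def)
    also have "(\<Sum>i\<in>{1..n}. of_bool (?i = i) * snd \<omega> i) - \<dots> =
        (\<Sum>i\<in>{1..n}. of_bool (?i = i) * snd \<omega> i - indicator (E i) \<omega> * cost (\<gamma> i))"
      by (simp add: sum_subtractf)
    \<comment> \<open>At the chosen box this is \<open>y = min y z + max 0 (y - z)\<close>; at the
      other opened boxes the excess is subtracted in \<open>surplus\<close> and added back.\<close>
    also have "\<dots> = surplus \<sigma> \<omega> +
      (\<Sum>i\<in>{1..n}. indicator (E i) \<omega> * max 0 (snd \<omega> i - z i) - indicator (E i) \<omega> * cost (\<gamma> i))"
      unfolding surplus_def sum.distrib[symmetric]
      using i \<omega> by (intro sum.cong refl) (auto simp: E_def of_bool_def indicator_def)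
    finally show ?thesis .
  qed
  then have "expected_payoff n \<gamma> F \<sigma> = (\<integral>\<omega>. surplus \<sigma> \<omega> +
      (\<Sum>i\<in>{1..n}. indicator (E i) \<omega> * max 0 (snd \<omega> i - z i) - indicator (E i) \<omega> * cost (\<gamma> i)) \<partial>J)"
    unfolding expected_payoff_def by (intro Bochner_Integration.integral_cong) (auto simp: case_prod_beta)
  also have "\<dots> = (\<integral>\<omega>. surplus \<sigma> \<omega> \<partial>J) + (\<Sum>i\<in>{1..n}. (\<integral>\<omega>. indicator (E i) \<omega> * max 0 (snd \<omega> i - z i) \<partial>J)
      - (\<integral>\<omega>. indicator (E i) \<omega> * cost (\<gamma> i) \<partial>J))"
  proof -
    have "(\<Sum>i\<in>{1..n}. (\<integral>\<omega>. indicator (E i) \<omega> * max 0 (snd \<omega> i - z i) \<partial>J)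
        - (\<integral>\<omega>. indicator (E i) \<omega> * cost (\<gamma> i) \<partial>J)) =
      (\<Sum>i\<in>{1..n}. \<integral>\<omega>. indicator (E i) \<omega> * max 0 (snd \<omega> i - z i)
        - indicator (E i) \<omega> * cost (\<gamma> i) \<partial>J)"
      using exc_E by (intro sum.cong refl Bochner_Integration.integral_diff[symmetric]) auto
    also have "\<dots> = (\<integral>\<omega>. (\<Sum>i\<in>{1..n}. indicator (E i) \<omega> * max 0 (snd \<omega> i - z i)
        - indicator (E i) \<omega> * cost (\<gamma> i)) \<partial>J)"
      using exc_E by (intro Bochner_Integration.integral_sum[symmetric] Bochner_Integration.integrable_diff) auto
    finally have sum_eq: "(\<Sum>i\<in>{1..n}. (\<integral>\<omega>. indicator (E i) \<omega> * max 0 (snd \<omega> i - z i) \<partial>J)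
        - (\<integral>\<omega>. indicator (E i) \<omega> * cost (\<gamma> i) \<partial>J)) = \<dots>" .
    show ?thesis
      unfolding sum_eq by (intro Bochner_Integration.integral_add integrable_surplus[OF \<sigma>]
          Bochner_Integration.integrable_sum Bochner_Integration.integrable_diff exc_E)
  qed
  also have "(\<Sum>i\<in>{1..n}. (\<integral>\<omega>. indicator (E i) \<omega> * max 0 (snd \<omega> i - z i) \<partial>J)
      - (\<integral>\<omega>. indicator (E i) \<omega> * cost (\<gamma> i) \<partial>J)) = 0"
    using invariant E sets.sets_into_space[OF E]
    by (intro sum.neutral ballI) (simp add: integral_excess[OF _ E] Int_absorb2)
  finally show ?thesis by simp
qed

section \<open>Pathwise maximality of the index rule and what optimality implies\<close>

lemma surplus_le:
  assumes "is_strategy n \<sigma>"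
  shows "surplus \<sigma> \<omega> \<le> min (snd \<omega> (chosen \<sigma> \<omega>)) (z (chosen \<sigma> \<omega>))"
proof -
  have "0 \<le> (\<Sum>i\<in>{1..n}. of_bool (i \<in> set (opened_list \<sigma> \<omega>) \<and> chosen \<sigma> \<omega> \<noteq> i) *
      max 0 (snd \<omega> i - z i))"
    by (intro sum_nonneg) simp
  then show ?thesis
    unfolding surplus_eq[OF assms] by linarith
qed

text \<open>Under both conditions the surplus equals the largest capped value over all boxes, opened
  or not, and no strategy can have a larger surplus at that outcome.\<close>

definition index_optimal_at :: "strategy \<Rightarrow> real \<times> (nat \<Rightarrow> real) \<Rightarrow> bool" where
  "index_optimal_at \<sigma> \<omega> \<longleftrightarrow>
     (\<forall>j\<in>set (opened_list \<sigma> \<omega>). j \<noteq> chosen \<sigma> \<omega> \<longrightarrow> snd \<omega> j \<le> z j) \<and>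
     (\<forall>j\<in>{1..n}. min (snd \<omega> j) (z j) \<le> min (snd \<omega> (chosen \<sigma> \<omega>)) (z (chosen \<sigma> \<omega>)))"

text \<open>The middle term is kept for the equality case: when the two surpluses agree, it shows
  that \<open>\<tau>\<close> loses nothing on unchosen boxes.\<close>

lemma surplus_le_index_optimal:
  assumes "is_strategy n \<sigma>" "is_strategy n \<tau>" "index_optimal_at \<sigma> \<omega>"
  shows "surplus \<tau> \<omega> \<le> min (snd \<omega> (chosen \<tau> \<omega>)) (z (chosen \<tau> \<omega>))"
    "min (snd \<omega> (chosen \<tau> \<omega>)) (z (chosen \<tau> \<omega>)) \<le> surplus \<sigma> \<omega>"
proof -
  have "chosen \<tau> \<omega> \<in> {1..n}"
    using chosen_box_in_opened legal_rule_stops(2) strategy_legal[OF assms(2)] by blast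
  moreover have "surplus \<sigma> \<omega> = min (snd \<omega> (chosen \<sigma> \<omega>)) (z (chosen \<sigma> \<omega>))"
    using assms(3) unfolding surplus_eq[OF assms(1)] index_optimal_at_def
    by (simp add: sum.neutral)
  ultimately show "min (snd \<omega> (chosen \<tau> \<omega>)) (z (chosen \<tau> \<omega>)) \<le> surplus \<sigma> \<omega>"
    using assms(3) by (simp add: index_optimal_at_def)
qed (rule surplus_le[OF assms(2)])

lemma optimal_if_index_optimal:
  assumes "is_strategy n \<sigma>" "AE \<omega> in J. index_optimal_at \<sigma> \<omega>"
  shows "optimal_strategy n \<gamma> F \<sigma>"
  unfolding optimal_strategy_def
proof (intro conjI allI impI)
  fix \<tau> assume \<tau>: "is_strategy n \<tau>"
  have "AE \<omega> in J. surplus \<tau> \<omega> \<le> surplus \<sigma> \<omega>"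
    using assms(2)
    by eventually_elim (use surplus_le_index_optimal[OF assms(1) \<tau>] in \<open>blast intro: order_trans\<close>)
  then show "expected_payoff n \<gamma> F \<tau> \<le> expected_payoff n \<gamma> F \<sigma>"
    unfolding expected_payoff_eq_surplus[OF \<tau>] expected_payoff_eq_surplus[OF assms(1)]
    by (intro integral_mono_AE integrable_surplus \<tau> assms(1))
qed fact

lemma index_optimal_strategy_exists:
  obtains \<tau> where "is_strategy n \<tau>" "\<And>\<omega>. index_optimal_at \<tau> \<omega>"
proof -
  define xs where "xs = sort_key (\<lambda>i. - z i) [1..<Suc n]"
  have set_xs: "set xs = {1..n}" by (auto simp: xs_def)
  moreover have "distinct xs" by (simp add: xs_def)
  moreover have "xs \<noteq> []" using boxes set_xs by auto
  ultimately have xs: "xs \<in> valid_lists n" by (simp add: valid_lists_def)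
  have "sorted (map (\<lambda>i. - z i) xs)" unfolding xs_def by (rule sorted_sort_key)
  then have sorted: "sorted_wrt (\<lambda>i j. z j \<le> z i) xs"
    by (simp add: sorted_wrt_map)
  define \<tau> :: strategy where "\<tau> u = list_rule xs z" for u
  have "is_strategy n (\<lambda>u. list_rule ((\<lambda>_. xs) u) z)"
    by (rule is_strategy_list_rule) (use xs in auto)
  then have "is_strategy n \<tau>" by (simp add: \<tau>_def[abs_def])
  moreover have "index_optimal_at \<tau> \<omega>" for \<omega>
    using list_rule_index[OF xs sorted] by (auto simp: index_optimal_at_def \<tau>_def set_xs)
  ultimately show thesis by (rule that)
qed

text \<open>The surplus of an index rule dominates that of \<open>\<sigma>\<close> everywhere, yet
  its expectation is no larger, so the two agree almost surely. The squeeze through the capped value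
  of the chosen box then makes every subtracted excess vanish.\<close>

lemma optimal_no_exposure:
  assumes "optimal_strategy n \<gamma> F \<sigma>"
  shows "AE \<omega> in J. \<forall>j\<in>set (opened_list \<sigma> \<omega>). j \<noteq> chosen \<sigma> \<omega> \<longrightarrow> snd \<omega> j \<le> z j"
proof -
  have \<sigma>: "is_strategy n \<sigma>" using assms by (simp add: optimal_strategy_def)
  obtain \<tau> where \<tau>: "is_strategy n \<tau>" "\<And>\<omega>. index_optimal_at \<tau> \<omega>"
    using index_optimal_strategy_exists by blast
  note le = surplus_le_index_optimal[OF \<tau>(1) \<sigma> \<tau>(2)]
  have int: "integrable J (\<lambda>\<omega>. surplus \<tau> \<omega> - surplus \<sigma> \<omega>)"
    by (intro Bochner_Integration.integrable_diff integrable_surplus \<tau> \<sigma>)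
  have nonneg: "0 \<le> surplus \<tau> \<omega> - surplus \<sigma> \<omega>" for \<omega>
    using le[of \<omega>] by linarith
  have "(\<integral>\<omega>. surplus \<tau> \<omega> - surplus \<sigma> \<omega> \<partial>J) =
      expected_payoff n \<gamma> F \<tau> - expected_payoff n \<gamma> F \<sigma>"
    by (simp add: expected_payoff_eq_surplus \<tau> \<sigma> integrable_surplus Bochner_Integration.integral_diff)
  also have "\<dots> \<le> 0" using assms \<tau>(1) by (simp add: optimal_strategy_def)
  finally have "(\<integral>\<omega>. surplus \<tau> \<omega> - surplus \<sigma> \<omega> \<partial>J) = 0"
    using Bochner_Integration.integral_nonneg[of J "\<lambda>\<omega>. surplus \<tau> \<omega> - surplus \<sigma> \<omega>"] nonneg by force
  then have "AE \<omega> in J. surplus \<tau> \<omega> - surplus \<sigma> \<omega> = 0"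
    using integral_nonneg_eq_0_iff_AE[OF int] nonneg by simp
  then show ?thesis
  proof eventually_elim
    case (elim \<omega>)
    let ?e = "\<lambda>i. of_bool (i \<in> set (opened_list \<sigma> \<omega>) \<and> chosen \<sigma> \<omega> \<noteq> i) * max 0 (snd \<omega> i - z i)"
    have "(\<Sum>i\<in>{1..n}. ?e i) \<le> 0"
      using elim le[of \<omega>] surplus_eq[OF \<sigma>, of \<omega>] by linarith
    then have "\<forall>i\<in>{1..n}. ?e i = 0"
      by (subst sum_nonneg_eq_0_iff[symmetric]) (auto intro!: antisym sum_nonneg)
    moreover have "set (opened_list \<sigma> \<omega>) \<subseteq> {1..n}"
      using legal_rule_stops(2) strategy_legal[OF \<sigma>] by blast
    ultimately show ?case by (auto simp: max_def split: if_splits)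
  qed
qed

text \<open>The expected excess equals the cost, and it would be 0 if \<open>z i\<close> were almost
  never exceeded.\<close>

lemma exceeds_reservation_pos:
  assumes "i \<in> {1..n}" "0 < cost (\<gamma> i)"
  shows "0 < measure (F i) {z i<..}"
proof (rule ccontr)
  assume "\<not> 0 < measure (F i) {z i<..}"
  then have "measure (F i) {z i<..} = 0" using zero_less_measure_iff by blast
  then have "emeasure (F i) {z i<..} = 0" by (simp add: M.emeasure_eq_measure)
  then have "AE t in F i. t \<notin> {z i<..}" by (intro AE_I[where N = "{z i<..}"]) auto
  then have "(\<integral>t. max 0 (t - z i) \<partial>F i) = (\<integral>t. 0 \<partial>F i)"
    by (intro integral_cong_AE) (auto elim!: eventually_mono)
  then show False using reservation[OF assms(1)] assms(2) by simp
qed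

text \<open>Opening a box \<open>j\<close> after an exposed box \<open>i\<close> would, with positive probability, expose \<open>j\<close> too,
  but only one of the two can be chosen.\<close>

lemma optimal_stops_after_exposure:
  assumes opt: "optimal_strategy n \<gamma> F \<sigma>"
    and cost: "\<And>i. i \<in> {1..n} \<Longrightarrow> 0 < cost (\<gamma> i)"
  shows "AE \<omega> in J. \<forall>j\<in>set (opened_list \<sigma> \<omega>).
    \<forall>i\<in>set (takeWhile (\<lambda>k. k \<noteq> j) (opened_list \<sigma> \<omega>)). snd \<omega> i \<le> z i"
proof -
  have \<sigma>: "is_strategy n \<sigma>" using opt by (simp add: optimal_strategy_def)
  have sub: "set (opened_list \<sigma> \<omega>) \<subseteq> {1..n}" for \<omega>
    using legal_rule_stops(2) strategy_legal[OF \<sigma>] by blast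
  have "AE \<omega> in J. j \<in> set (opened_list \<sigma> \<omega>) \<longrightarrow>
      i \<in> set (takeWhile (\<lambda>k. k \<noteq> j) (opened_list \<sigma> \<omega>)) \<longrightarrow> snd \<omega> i \<le> z i"
    if ij: "i \<in> {1..n}" "j \<in> {1..n}" for i j
  proof -
    define E where "E = {\<omega>\<in>space J. j \<in> set (opened_list \<sigma> \<omega>) \<and>
        i \<in> set (takeWhile (\<lambda>k. k \<noteq> j) (opened_list \<sigma> \<omega>))} \<inter> {\<omega>\<in>space J. z i < snd \<omega> i}"
    have "{\<omega>\<in>space J. z i < snd \<omega> i} \<in> sets J"
      using ij by (intro borel_measurable_less) auto
    then have E: "E \<in> sets J"
      unfolding E_def by (intro sets.Int pred_opened_list[OF \<sigma>])
    \<comment> \<open>\<open>E\<close> refers to the list before \<open>j\<close> and to the value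
      of a box in it, which is necessarily different from \<open>j\<close>; neither reacts to
      \<open>y j\<close>.\<close>
    have invariant: "(u, y(j := t)) \<in> E \<longleftrightarrow> (u, y) \<in> E" if "(u, y) \<in> space J" for u y t
    proof -
      have "(u, y(j := t)) \<in> space J"
        using that ij(2) by (auto simp: space_J space_PiM PiE_def extensional_def)
      moreover have "j \<notin> set (takeWhile (\<lambda>k. k \<noteq> j) xs)" for xs :: "nat list"
        by (auto dest: set_takeWhileD)
      ultimately show ?thesis
        using that opened_before_fun_upd[of j n "\<sigma> u" y t]
        by (cases "i = j") (auto simp: E_def in_opened_fun_upd)
    qed
    have "AE \<omega> in J. \<omega> \<notin> {\<omega>\<in>E. snd \<omega> j \<in> {z j<..}}"
      using optimal_no_exposure[OF opt]
    proof eventually_elim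
      case (elim \<omega>)
      show ?case
      proof
        assume \<omega>: "\<omega> \<in> {\<omega>\<in>E. snd \<omega> j \<in> {z j<..}}"
        then have "i \<in> set (opened_list \<sigma> \<omega>)" "i \<noteq> j"
          by (auto simp: E_def dest: set_takeWhileD)
        moreover have "j \<in> set (opened_list \<sigma> \<omega>)" "z i < snd \<omega> i" "z j < snd \<omega> j"
          using \<omega> by (auto simp: E_def)
        ultimately show False using elim by (metis not_less)
      qed
    qed
    then have "J.prob {\<omega>\<in>E. snd \<omega> j \<in> {z j<..}} = 0"
      using sets_restrict_value[OF ij(2) E, of "{z j<..}"] by (subst measure_eq_AE[where B = "{}"]) auto
    then have "J.prob E = 0"
      using prob_independent[OF ij(2) E _ invariant, of "{z j<..}"]
        exceeds_reservation_pos[OF ij(2) cost[OF ij(2)]] by simp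
    then have "emeasure J E = 0" by (simp add: J.emeasure_eq_measure)
    then have "AE \<omega> in J. \<omega> \<notin> E" using E by (intro AE_I[where N = E]) auto
    with AE_space show ?thesis
      by eventually_elim (auto simp: E_def not_less)
  qed
  then have "AE \<omega> in J. \<forall>i\<in>{1..n}. \<forall>j\<in>{1..n}. j \<in> set (opened_list \<sigma> \<omega>) \<longrightarrow>
      i \<in> set (takeWhile (\<lambda>k. k \<noteq> j) (opened_list \<sigma> \<omega>)) \<longrightarrow> snd \<omega> i \<le> z i"
    by (intro AE_finite_allI) auto
  then show ?thesis
    by eventually_elim (use sub in \<open>blast dest: set_takeWhileD\<close>)
qed

end

section \<open>Bounds on search behaviors\<close>

text \<open>Being in position \<open>r\<close>, counted from 0, among the listed elements satisfying
  \<open>P\<close> is expressed through the part of the list before \<open>i\<close>. For runs this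
  makes the event unaffected by \<open>y i\<close>.\<close>

lemma nth_filter_eq_iff:
  assumes "distinct xs" "P i"
  shows "r < length (filter P xs) \<and> filter P xs ! r = i \<longleftrightarrow>
    i \<in> set xs \<and> length (filter P (takeWhile (\<lambda>k. k \<noteq> i) xs)) = r"
proof (cases "i \<in> set xs")
  case True
  then obtain ys zs where xs: "xs = ys @ i # zs" "i \<notin> set ys"
    by (meson split_list_first)
  have "takeWhile (\<lambda>k. k \<noteq> i) xs = ys"
    using xs(2) unfolding xs(1) by (subst takeWhile_append2) auto
  moreover have filter: "filter P xs = filter P ys @ i # filter P zs" "distinct (filter P xs)"
    using xs assms by auto
  ultimately show ?thesis
    using True nth_eq_iff_index_eq[OF filter(2), of r "length (filter P ys)"]
    by (auto simp: filter(1))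
next
  case False
  then show ?thesis by (metis filter_is_subset nth_mem subsetD)
qed

context pandora_search
begin

definition open_prob :: "strategy \<Rightarrow> nat \<Rightarrow> real" where
  "open_prob \<sigma> i = J.prob {\<omega>\<in>space J. i \<in> set (opened_list \<sigma> \<omega>)}"

lemma search_behavior_eq: "search_behavior n F \<sigma> = (\<lambda>i\<in>{1..n}. open_prob \<sigma> i)"
  unfolding search_behavior_def open_prob_def by (simp add: case_prod_beta' split_beta')

lemma sum_open_prob_ge_1:
  assumes \<sigma>: "is_strategy n \<sigma>"
  shows "1 \<le> (\<Sum>i\<in>{1..n}. open_prob \<sigma> i)"
proof -
  have "\<exists>i\<in>{1..n}. i \<in> set (opened_list \<sigma> \<omega>)" for \<omega>
    using chosen_box_in_opened legal_rule_stops(2) strategy_legal[OF \<sigma>] by blast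
  then have "(\<Union>i\<in>{1..n}. {\<omega>\<in>space J. i \<in> set (opened_list \<sigma> \<omega>)}) = space J"
    by auto
  then have "1 = J.prob (\<Union>i\<in>{1..n}. {\<omega>\<in>space J. i \<in> set (opened_list \<sigma> \<omega>)})"
    by (simp add: J.prob_space)
  also have "\<dots> \<le> (\<Sum>i\<in>{1..n}. open_prob \<sigma> i)"
    unfolding open_prob_def
    by (intro J.finite_measure_subadditive_finite) (use pred_opened_list[OF \<sigma>] in auto)
  finally show ?thesis .
qed

lemma sum_open_prob_le:
  assumes opt: "optimal_strategy n \<gamma> F \<sigma>"
    and cost: "\<And>i. i \<in> {1..n} \<Longrightarrow> 0 < cost (\<gamma> i)"
    and q: "\<And>i. i \<in> S \<Longrightarrow> q \<le> measure (F i) {z i<..}" "q \<le> 1"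
    and S: "S \<subseteq> {1..n}"
  shows "(\<Sum>i\<in>S. open_prob \<sigma> i) \<le> (\<Sum>r<card S. (1 - q) ^ r)"
proof -
  have \<sigma>: "is_strategy n \<sigma>" using opt by (simp add: optimal_strategy_def)
  have [simp]: "finite S" using S finite_subset by blast
  define L where "L \<omega> = filter (\<lambda>i. i \<in> S) (opened_list \<sigma> \<omega>)" for \<omega>
  have distinct: "distinct (opened_list \<sigma> \<omega>)" for \<omega>
    using legal_rule_stops(1) strategy_legal[OF \<sigma>] by blast
  have set_L: "set (L \<omega>) = S \<inter> set (opened_list \<sigma> \<omega>)" for \<omega> by (auto simp: L_def)
  have length_L: "length (L \<omega>) = card (S \<inter> set (opened_list \<sigma> \<omega>))" for \<omega>
    unfolding set_L[symmetric] by (rule distinct_card[symmetric]) (simp add: L_def distinct)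
  have L_events: "{\<omega>\<in>space J. P (L \<omega>)} \<in> sets J" for P
    unfolding L_def by (rule pred_opened_list[OF \<sigma>])
  \<comment> \<open>\<open>a r\<close> is the probability that more than \<open>r\<close> boxes of
    \<open>S\<close> are opened; \<open>E r i\<close> splits this event according to the box in
    position \<open>r\<close>.\<close>
  define a where "a r = J.prob {\<omega>\<in>space J. r < length (L \<omega>)}" for r
  define E where "E r i = {\<omega>\<in>space J. r < length (L \<omega>) \<and> L \<omega> ! r = i}" for r i
  have E_eq: "E r i = {\<omega>\<in>space J. i \<in> set (opened_list \<sigma> \<omega>) \<and>
      length (filter (\<lambda>i. i \<in> S) (takeWhile (\<lambda>k. k \<noteq> i) (opened_list \<sigma> \<omega>))) = r}" if "i \<in> S" for r i
    unfolding E_def L_def by (subst nth_filter_eq_iff[OF distinct]) (use that in auto)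
  have E_sets [simp]: "E r i \<in> sets J" for r i
    unfolding E_def by (rule L_events)
  have disjoint: "disjoint_family_on (E r) S" for r
    by (auto simp: disjoint_family_on_def E_def)
  have a_eq: "a r = (\<Sum>i\<in>S. J.prob (E r i))" for r
  proof -
    have "{\<omega>\<in>space J. r < length (L \<omega>)} = (\<Union>i\<in>S. E r i)"
      using set_L nth_mem by (fastforce simp: E_def)
    then show ?thesis
      using disjoint[of r] unfolding a_def by (simp add: J.finite_measure_finite_Union image_subset_iff)
  qed
  have exposed: "J.prob {\<omega>\<in>E r i. snd \<omega> i \<in> {z i<..}} = J.prob (E r i) * measure (F i) {z i<..}"
    if "i \<in> S" for r i
  proof (rule prob_independent)
    fix u y t assume uy: "(u, y) \<in> space J"
    then have "(u, y(i := t)) \<in> space J"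
      using S that by (auto simp: space_J space_PiM PiE_def extensional_def)
    with uy show "(u, y(i := t)) \<in> E r i \<longleftrightarrow> (u, y) \<in> E r i"
      using opened_before_fun_upd[of i n "\<sigma> u" y t]
      by (auto simp: E_eq[OF that] in_opened_fun_upd)
  qed (use that S in auto)
  have stops: "AE \<omega> in J. \<forall>j\<in>set (opened_list \<sigma> \<omega>).
      \<forall>i\<in>set (takeWhile (\<lambda>k. k \<noteq> j) (opened_list \<sigma> \<omega>)). snd \<omega> i \<le> z i"
    by (rule optimal_stops_after_exposure[OF opt]) (rule cost)
  \<comment> \<open>If the box of \<open>S\<close> in position \<open>r\<close> is exposed, the run
    ends with exactly \<open>Suc r\<close> boxes of \<open>S\<close>. This has probability at least
    \<open>q * a r\<close>, and at most \<open>a r - a (Suc r)\<close>.\<close>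
  have a_Suc: "a (Suc r) \<le> (1 - q) * a r" for r
  proof -
    have "q * a r \<le> (\<Sum>i\<in>S. J.prob (E r i) * measure (F i) {z i<..})"
      unfolding a_eq sum_distrib_left
      by (intro sum_mono) (use q(1) in \<open>auto simp: mult.commute intro!: mult_right_mono\<close>)
    also have "\<dots> = (\<Sum>i\<in>S. J.prob {\<omega>\<in>E r i. snd \<omega> i \<in> {z i<..}})"
      by (intro sum.cong refl exposed[symmetric])
    also have "\<dots> = J.prob (\<Union>i\<in>S. {\<omega>\<in>E r i. snd \<omega> i \<in> {z i<..}})"
    proof (rule J.finite_measure_finite_Union[symmetric])
      show "(\<lambda>i. {\<omega>\<in>E r i. snd \<omega> i \<in> {z i<..}}) ` S \<subseteq> J.events"
        using S by (intro image_subsetI sets_restrict_value) auto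
      show "disjoint_family_on (\<lambda>i. {\<omega>\<in>E r i. snd \<omega> i \<in> {z i<..}}) S"
        using disjoint[of r] by (auto simp: disjoint_family_on_def)
    qed simp
    also have "\<dots> \<le> J.prob {\<omega>\<in>space J. length (L \<omega>) = Suc r}"
    proof (rule J.finite_measure_mono_AE)
      show "AE \<omega> in J. \<omega> \<in> (\<Union>i\<in>S. {\<omega>\<in>E r i. snd \<omega> i \<in> {z i<..}}) \<longrightarrow>
          \<omega> \<in> {\<omega>\<in>space J. length (L \<omega>) = Suc r}"
        using stops
      proof eventually_elim
        case (elim \<omega>)
        show ?case
        proof
          assume "\<omega> \<in> (\<Union>i\<in>S. {\<omega>\<in>E r i. snd \<omega> i \<in> {z i<..}})"
          then obtain i where i: "i \<in> S" "\<omega> \<in> E r i" "z i < snd \<omega> i" by auto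
          then have i_opened: "i \<in> set (opened_list \<sigma> \<omega>)" by (simp add: E_eq)
          then obtain ys zs where split: "opened_list \<sigma> \<omega> = ys @ i # zs" "i \<notin> set ys"
            by (meson split_list_first)
          have "zs = []"
          proof (rule ccontr)
            assume "zs \<noteq> []"
            then obtain j zs' where zs: "zs = j # zs'" by (cases zs) auto
            have "j \<notin> set ys" "j \<noteq> i" using distinct[of \<omega>] split zs by auto
            then have "i \<in> set (takeWhile (\<lambda>k. k \<noteq> j) (opened_list \<sigma> \<omega>))"
              unfolding split(1) zs by (subst takeWhile_append2) auto
            moreover have "j \<in> set (opened_list \<sigma> \<omega>)" using split zs by simp
            ultimately show False using elim i(3) by force
          qed
          then have "takeWhile (\<lambda>k. k \<noteq> i) (opened_list \<sigma> \<omega>) = ys"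
            using split(2) unfolding split(1) by (subst takeWhile_append2) auto
          then have "length (filter (\<lambda>i. i \<in> S) ys) = r"
            using i(1,2) by (simp add: E_eq)
          then show "\<omega> \<in> {\<omega>\<in>space J. length (L \<omega>) = Suc r}"
            using split \<open>zs = []\<close> i by (simp add: L_def E_def)
        qed
      qed
    qed (rule L_events)
    also have "\<dots> = J.prob ({\<omega>\<in>space J. r < length (L \<omega>)} - {\<omega>\<in>space J. Suc r < length (L \<omega>)})"
      by (intro arg_cong[where f = J.prob]) auto
    also have "\<dots> = a r - a (Suc r)"
      unfolding a_def by (intro J.finite_measure_Diff L_events) auto
    finally show ?thesis by (simp add: algebra_simps)
  qed
  have a_le: "a r \<le> (1 - q) ^ r" for r
  proof (induction r)
    case (Suc r)
    have "(1 - q) * a r \<le> (1 - q) * (1 - q) ^ r"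
      using Suc q(2) by (intro mult_left_mono) auto
    with a_Suc[of r] show ?case by simp
  qed (simp add: a_def)
  have integral_indicators: "(\<integral>\<omega>. (\<Sum>i\<in>A. indicator (B i) \<omega>) \<partial>J) = (\<Sum>i\<in>A. J.prob (B i))"
    if B: "\<And>i. i \<in> A \<Longrightarrow> B i \<in> sets J" for A :: "nat set" and B
  proof -
    have "integrable J (indicator (B i) :: _ \<Rightarrow> real)" if "i \<in> A" for i
      using B[OF that] by (simp add: less_top[symmetric])
    then show ?thesis
      using sets.sets_into_space[OF B]
      by (subst Bochner_Integration.integral_sum) (auto simp: Int_absorb2 intro!: sum.cong)
  qed
  \<comment> \<open>Tail-sum formula: the expected number of opened boxes of \<open>S\<close> is the
    sum of the probabilities that more than \<open>r\<close> of them are opened.\<close>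
  have "(\<Sum>i\<in>S. open_prob \<sigma> i) = (\<integral>\<omega>. (\<Sum>i\<in>S. indicator {\<omega>\<in>space J. i \<in> set (opened_list \<sigma> \<omega>)} \<omega>) \<partial>J)"
    unfolding open_prob_def by (intro integral_indicators[symmetric] pred_opened_list[OF \<sigma>])
  also have "\<dots> = (\<integral>\<omega>. (\<Sum>r<card S. indicator {\<omega>\<in>space J. r < length (L \<omega>)} \<omega>) \<partial>J)"
  proof (rule Bochner_Integration.integral_cong[OF refl])
    fix \<omega> assume \<omega>: "\<omega> \<in> space J"
    have "(\<Sum>i\<in>S. indicator {\<omega>\<in>space J. i \<in> set (opened_list \<sigma> \<omega>)} \<omega>) = real (length (L \<omega>))"
      using \<omega> by (simp add: length_L indicator_def Int_def)
    moreover have "length (L \<omega>) \<le> card S"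
      unfolding length_L by (intro card_mono) auto
    then have "{..<card S} \<inter> {r. r < length (L \<omega>)} = {..<length (L \<omega>)}" by auto
    then have "(\<Sum>r<card S. indicator {\<omega>\<in>space J. r < length (L \<omega>)} \<omega>) = real (length (L \<omega>))"
      using \<omega> by (simp add: indicator_def)
    ultimately show "(\<Sum>i\<in>S. indicator {\<omega>\<in>space J. i \<in> set (opened_list \<sigma> \<omega>)} \<omega>) =
        (\<Sum>r<card S. indicator {\<omega>\<in>space J. r < length (L \<omega>)} \<omega> :: real)" by simp
  qed
  also have "\<dots> = (\<Sum>r<card S. a r)"
    unfolding a_def by (intro integral_indicators L_events)
  also have "\<dots> \<le> (\<Sum>r<card S. (1 - q) ^ r)"
    by (intro sum_mono a_le)
  finally show ?thesis .
qed

end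

section \<open>Mixtures of list rules\<close>

text \<open>Opening probabilities when the search along \<open>xs\<close> survives each box
  independently with probability \<open>p\<close>. The position, counted from 0, is the length of a
  \<open>takeWhile\<close> because this commutes with relabelling the boxes.\<close>

definition list_behavior :: "real \<Rightarrow> nat list \<Rightarrow> nat \<Rightarrow> real" where
  "list_behavior p xs i = (if i \<in> set xs then p ^ length (takeWhile (\<lambda>k. k \<noteq> i) xs) else 0)"

lemma takeWhile_neq_nth:
  assumes "distinct xs" "k < length xs"
  shows "takeWhile (\<lambda>j. j \<noteq> xs ! k) xs = take k xs"
  using assms by (intro takeWhile_eq_take_P_nth) (auto simp: nth_eq_iff_index_eq)

lemma list_behavior_nth:
  assumes "distinct xs" "k < length xs"
  shows "list_behavior p xs (xs ! k) = p ^ k"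
  using assms by (simp add: list_behavior_def takeWhile_neq_nth)

lemma list_behavior_map:
  assumes "inj \<pi>"
  shows "list_behavior p (map \<pi> xs) (\<pi> i) = list_behavior p xs i"
  using assms by (simp add: list_behavior_def takeWhile_map o_def inj_eq inj_image_mem_iff)

lemma sum_list_behavior_upt:
  "(\<Sum>i=1..k. list_behavior p [1..<Suc m] i) = (\<Sum>j<min k m. p ^ j)"
proof -
  have eq: "list_behavior p [1..<Suc m] (Suc j) = (if j < m then p ^ j else 0)" for j
  proof (cases "j < m")
    case True
    then show ?thesis using list_behavior_nth[of "[1..<Suc m]" j p] by (simp del: upt_Suc)
  qed (simp add: list_behavior_def del: upt_Suc)
  have "(\<Sum>i=1..k. list_behavior p [1..<Suc m] i) = (\<Sum>j<k. if j < m then p ^ j else 0)"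
    by (simp only: One_nat_def sum.atLeast1_atMost_eq flip: eq)
  also have "\<dots> = (\<Sum>j\<in>{..<k} \<inter> {j. j < m}. p ^ j)"
    by (simp add: sum.inter_restrict[symmetric] sum.If_cases)
  also have "{..<k} \<inter> {j. j < m} = {..<min k m}" by auto
  finally show ?thesis .
qed

text \<open>The convex hull of the list behaviors, constrained on \<open>{1..n}\<close> only; this
  gives the closure under changes elsewhere that \<open>majorized_in_convex_symmetric\<close> asks
  for.\<close>

definition list_mixtures :: "nat \<Rightarrow> real \<Rightarrow> (nat \<Rightarrow> real) set" where
  "list_mixtures n p = {x. \<exists>a. (\<forall>xs\<in>valid_lists n. 0 \<le> a xs) \<and> (\<Sum>xs\<in>valid_lists n. a xs) = 1 \<and>
     (\<forall>i\<in>{1..n}. x i = (\<Sum>xs\<in>valid_lists n. a xs * list_behavior p xs i))}"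

lemma list_behavior_in_mixtures:
  assumes "xs \<in> valid_lists n"
  shows "list_behavior p xs \<in> list_mixtures n p"
  unfolding list_mixtures_def mem_Collect_eq
  by (rule exI[of _ "\<lambda>ys. of_bool (ys = xs)"])
    (use assms finite_valid_lists[of n] in \<open>simp add: of_bool_def if_distrib[of "\<lambda>x. x * _"] cong: if_cong\<close>)

lemma list_mixtures_convex:
  assumes "x \<in> list_mixtures n p" "x' \<in> list_mixtures n p" "0 \<le> t" "t \<le> 1"
  shows "(\<lambda>i. (1 - t) * x i + t * x' i) \<in> list_mixtures n p"
proof -
  obtain a where a: "\<forall>xs\<in>valid_lists n. 0 \<le> a xs" "(\<Sum>xs\<in>valid_lists n. a xs) = 1"
    "\<forall>i\<in>{1..n}. x i = (\<Sum>xs\<in>valid_lists n. a xs * list_behavior p xs i)"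
    using assms(1) by (auto simp: list_mixtures_def)
  obtain a' where a': "\<forall>xs\<in>valid_lists n. 0 \<le> a' xs" "(\<Sum>xs\<in>valid_lists n. a' xs) = 1"
    "\<forall>i\<in>{1..n}. x' i = (\<Sum>xs\<in>valid_lists n. a' xs * list_behavior p xs i)"
    using assms(2) by (auto simp: list_mixtures_def)
  show ?thesis
    unfolding list_mixtures_def mem_Collect_eq
  proof (intro exI[of _ "\<lambda>xs. (1 - t) * a xs + t * a' xs"] conjI ballI)
    show "(\<Sum>xs\<in>valid_lists n. (1 - t) * a xs + t * a' xs) = 1"
      using a(2) a'(2) by (simp add: sum.distrib flip: sum_distrib_left)
    show "(1 - t) * x i + t * x' i =
        (\<Sum>xs\<in>valid_lists n. ((1 - t) * a xs + t * a' xs) * list_behavior p xs i)"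
      if "i \<in> {1..n}" for i
    proof -
      have "(\<Sum>xs\<in>valid_lists n. ((1 - t) * a xs + t * a' xs) * list_behavior p xs i) =
          (1 - t) * (\<Sum>xs\<in>valid_lists n. a xs * list_behavior p xs i) +
          t * (\<Sum>xs\<in>valid_lists n. a' xs * list_behavior p xs i)"
        by (simp only: distrib_right sum.distrib sum_distrib_left mult.assoc)
      then show ?thesis using a(3) a'(3) that by simp
    qed
  qed (use a(1) a'(1) assms(3,4) in auto)
qed

text \<open>Relabelling the boxes by a transposition permutes the valid lists, so the weights are
  transported along this involution.\<close>

lemma list_mixtures_transpose:
  assumes "x \<in> list_mixtures n p" "j \<in> {1..n}" "k \<in> {1..n}"
  shows "x \<circ> Transposition.transpose j k \<in> list_mixtures n p"
proof -
  let ?\<pi> = "Transposition.transpose j k"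
  obtain a where a: "\<forall>xs\<in>valid_lists n. 0 \<le> a xs" "(\<Sum>xs\<in>valid_lists n. a xs) = 1"
    "\<forall>i\<in>{1..n}. x i = (\<Sum>xs\<in>valid_lists n. a xs * list_behavior p xs i)"
    using assms(1) by (auto simp: list_mixtures_def)
  have \<pi>_in: "?\<pi> i \<in> {1..n}" if "i \<in> {1..n}" for i
    using that assms(2,3) by (auto simp: Transposition.transpose_def)
  have map_valid: "map ?\<pi> xs \<in> valid_lists n" if "xs \<in> valid_lists n" for xs
    using that \<pi>_in by (auto simp: valid_lists_def distinct_map image_subset_iff)
  have bij: "bij_betw (map ?\<pi>) (valid_lists n) (valid_lists n)"
    by (rule bij_betw_byWitness[where f' = "map ?\<pi>"]) (auto simp: map_valid o_def)
  show ?thesis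
    unfolding list_mixtures_def mem_Collect_eq
  proof (intro exI[of _ "a \<circ> map ?\<pi>"] conjI ballI)
    show "(\<Sum>xs\<in>valid_lists n. (a \<circ> map ?\<pi>) xs) = 1"
      using sum.reindex_bij_betw[OF bij, of a] a(2) by simp
    show "(x \<circ> ?\<pi>) i = (\<Sum>xs\<in>valid_lists n. (a \<circ> map ?\<pi>) xs * list_behavior p xs i)"
      if "i \<in> {1..n}" for i
    proof -
      have "(x \<circ> ?\<pi>) i = (\<Sum>xs\<in>valid_lists n. a xs * list_behavior p xs (?\<pi> i))"
        using a(3) \<pi>_in[OF that] by simp
      also have "\<dots> = (\<Sum>xs\<in>valid_lists n. a (map ?\<pi> xs) * list_behavior p (map ?\<pi> xs) (?\<pi> i))"
        by (rule sum.reindex_bij_betw[OF bij, symmetric])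
      finally show ?thesis by (simp add: list_behavior_map)
    qed
  qed (use a(1) map_valid in auto)
qed

text \<open>The majorizing vector is the behavior of stopping after the first \<open>m\<close> or \<open>Suc m\<close> boxes,
  randomized so that the expected number of opened boxes agrees with that of \<open>v\<close>.\<close>

lemma submajorized_in_list_mixtures:
  assumes n: "2 \<le> n"
    and p: "0 \<le> p"
    and decreasing: "\<And>i j. 1 \<le> i \<Longrightarrow> i \<le> j \<Longrightarrow> j \<le> n \<Longrightarrow> v j \<le> v i"
    and nonneg: "0 \<le> v n"
    and total: "1 \<le> (\<Sum>i=1..n. v i)"
    and prefix: "\<And>k. k \<in> {1..n} \<Longrightarrow> (\<Sum>j=1..k. v j) \<le> (\<Sum>j<k. p ^ j)"
  shows "v \<in> list_mixtures n p"
proof -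
  define T where "T = (\<Sum>i=1..n. v i)"
  define g where "g k = (\<Sum>j<k. p ^ j)" for k
  have T: "1 \<le> T" "T \<le> g n" using total prefix[of n] n by (auto simp: T_def g_def)
  have g_Suc: "g (Suc k) = g k + p ^ k" for k by (simp add: g_def)
  \<comment> \<open>The total \<open>T\<close> lies between \<open>g 1 = 1\<close> and
    \<open>g n\<close>, hence between two consecutive values of \<open>g\<close>;
    \<open>m < n\<close> keeps the list of length \<open>Suc m\<close> valid.\<close>
  have "\<exists>m. 1 \<le> m \<and> m < n \<and> g m \<le> T \<and> T \<le> g (Suc m)"
  proof (rule ccontr)
    assume none: "\<not> ?thesis"
    have "g k \<le> T \<and> (k < n \<longrightarrow> g (Suc k) < T)" if "1 \<le> k" "k \<le> n - 1" for k
      using that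
    proof (induction k rule: dec_induct)
      case base
      have "g 1 \<le> T" using T(1) by (simp add: g_def)
      then show ?case using none n by (metis not_less le_refl less_le_trans one_less_numeral_iff semiring_norm(76))
    next
      case (step k)
      then have "g (Suc k) < T" by simp
      then show ?case using none step n by (metis Suc_leI less_imp_le not_less le_SucI)
    qed
    moreover have "1 \<le> n - 1" "Suc (n - 1) = n" using n by auto
    ultimately have "g n < T" by (metis diff_less le_refl less_le_trans zero_less_one n pos2)
    then show False using T(2) by simp
  qed
  then obtain m where m: "1 \<le> m" "m < n" "g m \<le> T" "T \<le> g (Suc m)" by blast
  \<comment> \<open>As \<open>p\<close> is only assumed nonnegative, \<open>p ^ m\<close> may be 0;
    then the two values of \<open>g\<close> coincide and any weight works.\<close>
  obtain t where t: "0 \<le> t" "t \<le> 1" "(1 - t) * g m + t * g (Suc m) = T"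
  proof (cases "g (Suc m) = g m")
    case True
    then show thesis using m that[of 0] by simp
  next
    case False
    then have pos: "0 < p ^ m" using zero_le_power[OF p, of m] unfolding g_Suc by linarith
    define t where "t = (T - g m) / p ^ m"
    have t: "t * p ^ m = T - g m" using pos unfolding t_def by (metis nonzero_eq_divide_eq less_irrefl)
    have t01: "0 \<le> t" "t \<le> 1"
      using m pos unfolding g_Suc by (auto simp: t_def)
    have "(1 - t) * g m + t * g (Suc m) = T"
      unfolding g_Suc using t by (simp add: algebra_simps)
    with t01 show thesis by (intro that)
  qed
  define w where "w i = (1 - t) * list_behavior p [1..<Suc m] i + t * list_behavior p [1..<Suc (Suc m)] i" for i
  have valid: "[1..<Suc m] \<in> valid_lists n" "[1..<Suc (Suc m)] \<in> valid_lists n"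
    using m by (auto simp: valid_lists_def)
  have w_in: "w \<in> list_mixtures n p"
    unfolding w_def[abs_def] by (intro list_mixtures_convex list_behavior_in_mixtures valid t)
  have sum_w: "(\<Sum>i=1..k. w i) = (1 - t) * g (min k m) + t * g (min k (Suc m))" for k
    unfolding w_def g_def sum.distrib sum_distrib_left[symmetric] sum_list_behavior_upt by simp
  show ?thesis
  proof (rule majorized_in_convex_symmetric[where D = "list_mixtures n p" and w = w and n = n])
    show "x' \<in> list_mixtures n p"
      if "x \<in> list_mixtures n p" "\<And>i. i \<in> {1..n} \<Longrightarrow> x' i = x i" for x x'
      using that by (auto simp: list_mixtures_def)
    \<comment> \<open>Up to \<open>m\<close> the prefix sums of \<open>w\<close> are the largest
      permitted ones, \<open>g k\<close>; beyond \<open>m\<close> they equal \<open>T\<close>, which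
      bounds every prefix sum of the nonnegative vector \<open>v\<close>.\<close>
    show "(\<Sum>j=1..k. v j) \<le> (\<Sum>j=1..k. w j)" if "k \<in> {1..n}" for k
    proof (cases "k \<le> m")
      case True
      then have "(\<Sum>j=1..k. w j) = g k" unfolding sum_w by (simp add: algebra_simps)
      then show ?thesis using prefix[OF that] by (simp add: g_def)
    next
      case False
      then have "(\<Sum>j=1..k. w j) = T" unfolding sum_w using t(3) by (simp add: min_absorb2)
      moreover have "(\<Sum>j=1..k. v j) \<le> T"
        unfolding T_def using that nonneg decreasing
        by (intro sum_mono2) (auto intro: order_trans)
      ultimately show ?thesis by simp
    qed
    show "(\<Sum>j=1..n. v j) = (\<Sum>j=1..n. w j)"
      unfolding sum_w using t(3) m(2) by (simp add: T_def min_absorb2)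
  qed (use w_in list_mixtures_convex list_mixtures_transpose decreasing in blast)+
qed

section \<open>Realizing the mixtures by optimal strategies\<close>

context pandora_search
begin

text \<open>With a common index \<open>zl\<close>, the box in position \<open>k\<close> of the list
  is reached exactly when the \<open>k\<close> values before it are all at most \<open>zl\<close>,
  and these values are independent.\<close>

lemma measure_list_rule_opens:
  assumes xs: "xs \<in> valid_lists n" and i: "i \<in> {1..n}"
    and z: "\<And>i. z i = zl"
    and p: "\<And>i. i \<in> {1..n} \<Longrightarrow> measure (F i) {..zl} = p"
  shows "P.prob {y\<in>space (PiM {1..n} F). i \<in> set (opened n (list_rule xs z) y)} = list_behavior p xs i"
proof (cases "i \<in> set xs")
  case False
  then have empty: "{y\<in>space (PiM {1..n} F). i \<in> set (opened n (list_rule xs z) y)} = {}"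
    using opened_list_rule_subset[OF xs] by blast
  show ?thesis unfolding empty using False by (simp add: list_behavior_def)
next
  case True
  then obtain k where k: "k < length xs" "i = xs ! k" by (auto simp: in_set_conv_nth)
  have dist: "distinct xs" and sub: "set (take k xs) \<subseteq> {1..n}"
    using xs set_take_subset[of k xs] by (auto simp: valid_lists_def)
  have "i \<in> set (opened n (list_rule xs z) y) \<longleftrightarrow> (\<forall>j\<in>set (take k xs). y j \<in> {..zl})" for y
  proof -
    have "set (take k xs) = (!) xs ` {..<k}"
      using nth_image[of k xs] k by (simp add: atLeast0LessThan)
    then show ?thesis
      using nth_in_opened_list_rule[OF xs k(1), of z y] k(2) by (auto simp: z)
  qed
  then have "emeasure (PiM {1..n} F) {y\<in>space (PiM {1..n} F). i \<in> set (opened n (list_rule xs z) y)} =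
      (\<Prod>j\<in>set (take k xs). emeasure (F j) {..zl})"
    using emeasure_PiM_Collect[OF sub, of "\<lambda>_. {..zl}"] by simp
  also have "\<dots> = (\<Prod>j\<in>set (take k xs). ennreal p)"
    using sub p by (intro prod.cong refl) (auto simp: M.emeasure_eq_measure)
  also have "\<dots> = ennreal (p ^ k)"
    using p[OF i] measure_nonneg[of "F i" "{..zl}"] distinct_card[OF distinct_take[OF dist, of k]] k
    by (simp add: ennreal_power)
  finally have "P.prob {y\<in>space (PiM {1..n} F). i \<in> set (opened n (list_rule xs z) y)} = p ^ k"
    using p[OF i] measure_nonneg[of "F i" "{..zl}"] by (simp add: measure_def)
  then show ?thesis using list_behavior_nth[OF dist k(1)] k(2) by simp
qed

lemma open_prob_list_mixture:
  assumes X: "X \<in> borel \<rightarrow>\<^sub>M count_space UNIV" "\<And>u. X u \<in> valid_lists n" and i: "i \<in> {1..n}"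
    and z: "\<And>i. z i = zl"
    and p: "\<And>i. i \<in> {1..n} \<Longrightarrow> measure (F i) {..zl} = p"
  shows "open_prob (\<lambda>u. list_rule (X u) z) i =
    (\<Sum>xs\<in>valid_lists n. measure (uniform_measure lborel {0..1}) {u. X u = xs} * list_behavior p xs i)"
proof -
  let ?U = "uniform_measure lborel {0..1::real}"
  let ?A = "\<lambda>xs. {y\<in>space (PiM {1..n} F). i \<in> set (opened n (list_rule xs z) y)}"
  interpret U: prob_space ?U by (rule prob_space_uniform)
  have X_sets: "{u. X u = xs} \<in> sets ?U" for xs
    using measurable_sets[OF X(1), of "{xs}"] by (simp add: vimage_def)
  have A_sets: "?A xs \<in> sets (PiM {1..n} F)" if "xs \<in> valid_lists n" for xs
  proof -
    have "is_strategy n (\<lambda>u. list_rule ((\<lambda>_. xs) u) z)"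
      by (rule is_strategy_list_rule) (use that in auto)
    then have "{\<omega>\<in>space J. i \<in> set (opened_list (\<lambda>u. list_rule xs z) \<omega>)} \<in> sets J"
      by (intro pred_opened_list) simp
    \<comment> \<open>The section at \<open>u = 0\<close> of an event that does not depend on
      \<open>u\<close>.\<close>
    from sets_Pair1[OF this[unfolded joint_law_def], of 0] show ?thesis
      by (simp add: vimage_def space_pair_measure)
  qed
  have "{\<omega>\<in>space J. i \<in> set (opened_list (\<lambda>u. list_rule (X u) z) \<omega>)} =
      (\<Union>xs\<in>valid_lists n. {u. X u = xs} \<times> ?A xs)"
    using X(2) by (auto simp: space_J)
  then have "open_prob (\<lambda>u. list_rule (X u) z) i = J.prob (\<Union>xs\<in>valid_lists n. {u. X u = xs} \<times> ?A xs)"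
    by (simp add: open_prob_def)
  also have "\<dots> = (\<Sum>xs\<in>valid_lists n. J.prob ({u. X u = xs} \<times> ?A xs))"
  proof (rule J.finite_measure_finite_Union[OF finite_valid_lists])
    show "(\<lambda>xs. {u. X u = xs} \<times> ?A xs) ` valid_lists n \<subseteq> J.events"
      unfolding joint_law_def using X_sets A_sets by (auto intro!: pair_measureI)
  qed (auto simp: disjoint_family_on_def)
  also have "\<dots> = (\<Sum>xs\<in>valid_lists n. measure ?U {u. X u = xs} * list_behavior p xs i)"
  proof (intro sum.cong refl)
    fix xs assume xs: "xs \<in> valid_lists n"
    have "J.prob ({u. X u = xs} \<times> ?A xs) = measure ?U {u. X u = xs} * P.prob (?A xs)"
      unfolding joint_law_def measure_def
      using X_sets A_sets[OF xs] by (subst P.emeasure_pair_measure_Times) (auto simp: enn2real_mult)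
    then show "J.prob ({u. X u = xs} \<times> ?A xs) = measure ?U {u. X u = xs} * list_behavior p xs i"
      using measure_list_rule_opens[OF xs i z p] by simp
  qed
  finally show ?thesis .
qed

text \<open>If all indices equal \<open>zl\<close> and no value falls below it, every capped value
  is \<open>zl\<close>. Any box is then a maximal choice, any list is sorted by index, and boxes
  missing from the list cannot improve on it.\<close>

lemma optimal_list_mixture:
  assumes X: "X \<in> borel \<rightarrow>\<^sub>M count_space UNIV" "\<And>u. X u \<in> valid_lists n"
    and z: "\<And>i. z i = zl"
    and ge: "\<And>i. i \<in> {1..n} \<Longrightarrow> AE t in F i. zl \<le> t"
  shows "optimal_strategy n \<gamma> F (\<lambda>u. list_rule (X u) z)"
proof (rule optimal_if_index_optimal)
  show "is_strategy n (\<lambda>u. list_rule (X u) z)"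
    by (rule is_strategy_list_rule[OF X])
  have "AE \<omega> in J. zl \<le> snd \<omega> i" if "i \<in> {1..n}" for i
    using AE_value[OF that, of "{zl..}"] ge[OF that] by simp
  then have "AE \<omega> in J. \<forall>i\<in>{1..n}. zl \<le> snd \<omega> i"
    by (intro AE_finite_allI) auto
  then show "AE \<omega> in J. index_optimal_at (\<lambda>u. list_rule (X u) z) \<omega>"
  proof eventually_elim
    case (elim \<omega>)
    have "chosen (\<lambda>u. list_rule (X u) z) \<omega> \<in> {1..n}"
      using chosen_box_in_opened legal_rule_stops(2) legal_list_rule[OF X(2)] by blast
    moreover have "sorted_wrt (\<lambda>i j. z j \<le> z i) (X (fst \<omega>))"
      by (simp add: z sorted_wrt_iff_nth_less)
    note exposed = list_rule_index(1)[OF X(2) this, of _ "snd \<omega>"]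
    ultimately have "zl \<le> snd \<omega> (chosen (\<lambda>u. list_rule (X u) z) \<omega>)"
      using elim by blast
    then show ?case
      unfolding index_optimal_at_def z using exposed[unfolded z] by (simp add: min.coboundedI2)
  qed
qed

end

section \<open>Reservation values\<close>

lemma admissible_box_bounds:
  assumes "admissible_box b"
  shows "0 < cost b" "cost b < reward_high b - z_low b" "reward_low b < z_low b"
    "prior_mean b = z_low b + cost b"
proof -
  let ?d = "reward_high b - reward_low b"
  have b: "0 < cost b" "cost b < prob_high b * ?d" "0 < ?d" "prob_high b < 1"
    using assms by (auto simp: admissible_box_def)
  have "reward_high b - z_low b = (1 - prob_high b) * ?d + cost b"
    by (simp add: z_low_def algebra_simps)
  moreover have "0 < (1 - prob_high b) * ?d" using b by simp
  moreover have "z_low b - reward_low b = prob_high b * ?d - cost b"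
    by (simp add: z_low_def algebra_simps)
  ultimately show "0 < cost b" "cost b < reward_high b - z_low b" "reward_low b < z_low b"
    using b by linarith+
  show "prior_mean b = z_low b + cost b" by (simp add: prior_mean_def z_low_def)
qed

lemma continuation_prob_bounds:
  assumes "admissible_box b"
  shows "0 < continuation_prob b" "continuation_prob b < 1"
  using admissible_box_bounds[OF assms] by (auto simp: continuation_prob_def)

lemma feasible_distribution_support:
  assumes "feasible_distribution b M"
  shows "AE t in M. reward_low b \<le> t \<and> t \<le> reward_high b"
proof -
  interpret real_distribution M using assms by (simp add: feasible_distribution_def)
  have "AE t in M. t \<in> {reward_low b..reward_high b}"
    using assms by (intro AE_prob_1) (simp add: feasible_distribution_def)
  then show ?thesis by simp
qed

lemma feasible_distribution_integrable:
  assumes "feasible_distribution b M"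
  shows "integrable M (\<lambda>t. t)"
proof -
  interpret real_distribution M using assms by (simp add: feasible_distribution_def)
  show ?thesis
  proof (rule integrable_const_bound[where B = "\<bar>reward_low b\<bar> + \<bar>reward_high b\<bar>"])
    show "AE t in M. norm t \<le> \<bar>reward_low b\<bar> + \<bar>reward_high b\<bar>"
      using feasible_distribution_support[OF assms] by eventually_elim auto
  qed simp
qed

text \<open>The expected excess \<open>\<phi>\<close> is 1-Lipschitz, at least the cost at
  \<open>z_low b\<close> and 0 at the high reward. The intermediate value theorem thus yields a
  solution at or above \<open>z_low b\<close>, and this location is what the probability bound
  needs.\<close>

lemma reservation_value_exists:
  assumes b: "admissible_box b" and M: "feasible_distribution b M"
  shows "\<exists>r. (\<integral>t. max 0 (t - r) \<partial>M) = cost b \<and> 1 - continuation_prob b \<le> measure M {r<..}"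
proof -
  interpret real_distribution M using M by (simp add: feasible_distribution_def)
  note support = feasible_distribution_support[OF M]
  note bounds = admissible_box_bounds[OF b]
  have int: "integrable M (\<lambda>t. max 0 (t - r))" for r
    using feasible_distribution_integrable[OF M] by (intro integrable_max) auto
  define \<phi> where "\<phi> r = (\<integral>t. max 0 (t - r) \<partial>M)" for r
  have "1-lipschitz_on UNIV \<phi>"
  proof (rule lipschitz_onI)
    fix r r' :: real
    have "\<bar>\<phi> r - \<phi> r'\<bar> = \<bar>\<integral>t. max 0 (t - r) - max 0 (t - r') \<partial>M\<bar>"
      by (simp add: \<phi>_def int)
    also have "\<dots> \<le> (\<integral>t. \<bar>max 0 (t - r) - max 0 (t - r')\<bar> \<partial>M)"
      by (rule integral_abs_bound)
    also have "\<dots> \<le> (\<integral>t. \<bar>r - r'\<bar> \<partial>M)"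
      by (intro integral_mono integrable_abs Bochner_Integration.integrable_diff int) auto
    finally show "dist (\<phi> r) (\<phi> r') \<le> 1 * dist r r'"
      using prob_space by (simp add: dist_real_def)
  qed simp
  then have cont: "continuous_on {z_low b..reward_high b} \<phi>"
    by (blast intro: lipschitz_on_continuous_on continuous_on_subset)
  have "cost b = (\<integral>t. t - z_low b \<partial>M)"
    using M bounds(4) feasible_distribution_integrable[OF M] prob_space
    by (simp add: feasible_distribution_def)
  also have "\<dots> \<le> \<phi> (z_low b)"
    unfolding \<phi>_def using feasible_distribution_integrable[OF M] by (intro integral_mono int) auto
  finally have low: "cost b \<le> \<phi> (z_low b)" .
  have "\<phi> (reward_high b) = (\<integral>t. 0 \<partial>M)"
    unfolding \<phi>_def
  proof (rule integral_cong_AE)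
    show "AE t in M. max 0 (t - reward_high b) = 0"
      using support by eventually_elim simp
  qed simp_all
  then have high: "\<phi> (reward_high b) \<le> cost b" using bounds by simp
  obtain r where r: "z_low b \<le> r" "\<phi> r = cost b"
    using IVT2'[OF high low _ cont] bounds by fastforce
  have "cost b = \<phi> r" using r by simp
  \<comment> \<open>The excess vanishes off \<open>t > r\<close>, and there \<open>t - r\<close> is
    at most \<open>reward_high b - z_low b\<close> because \<open>z_low b \<le> r\<close>.\<close>
  also have "\<dots> \<le> (\<integral>t. (reward_high b - z_low b) * indicator {r<..} t \<partial>M)"
    unfolding \<phi>_def
  proof (intro integral_mono_AE int)
    show "AE t in M. max 0 (t - r) \<le> (reward_high b - z_low b) * indicator {r<..} t"
      using support by eventually_elim (use r bounds in \<open>auto simp: indicator_def\<close>)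
  qed (simp add: less_top[symmetric])
  also have "\<dots> = (reward_high b - z_low b) * measure M {r<..}" by simp
  finally have "1 - continuation_prob b \<le> measure M {r<..}"
    using bounds by (simp add: continuation_prob_def field_simps)
  with r show ?thesis by (auto simp: \<phi>_def)
qed

text \<open>The extremal distribution: its reservation value \<open>z_low b\<close> is the lowest value in its support,
  so that Pandora is indifferent between stopping and opening any unopened box until she draws the
  high reward.\<close>

definition extremal_distribution :: "box \<Rightarrow> real measure" where
  "extremal_distribution b = distr (measure_pmf (bernoulli_pmf (1 - continuation_prob b))) borel
     (\<lambda>high. if high then reward_high b else z_low b)"

lemma extremal_distribution_props:
  assumes b: "admissible_box b"
  shows "feasible_distribution b (extremal_distribution b)"
    "(\<integral>t. max 0 (t - z_low b) \<partial>extremal_distribution b) = cost b"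
    "AE t in extremal_distribution b. z_low b \<le> t"
    "measure (extremal_distribution b) {..z_low b} = continuation_prob b"
proof -
  let ?f = "\<lambda>high. if high then reward_high b else z_low b"
  let ?q = "1 - continuation_prob b"
  note bounds = admissible_box_bounds[OF b]
  \<comment> \<open>The last equation does double duty: it gives the mean
    \<open>z_low b + cost b\<close>, which is the prior mean, and the reservation equation at
    \<open>z_low b\<close>.\<close>
  have q: "0 \<le> ?q" "?q \<le> 1" "?q * (reward_high b - z_low b) = cost b"
    using continuation_prob_bounds[OF b] bounds by (auto simp: continuation_prob_def)
  have [simp]: "?f \<in> measurable (measure_pmf (bernoulli_pmf ?q)) borel" by simp
  have integral: "(\<integral>t. g t \<partial>extremal_distribution b) = g (reward_high b) * ?q + g (z_low b) * (1 - ?q)"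
    if [measurable]: "g \<in> borel_measurable borel" for g :: "real \<Rightarrow> real"
    unfolding extremal_distribution_def using q(1,2)
    by (subst integral_distr) (simp_all add: integral_bernoulli_pmf)
  have measure: "measure (extremal_distribution b) A = measure (measure_pmf (bernoulli_pmf ?q)) (?f -` A)"
    if "A \<in> sets borel" for A
    unfolding extremal_distribution_def using that by (subst measure_distr) auto
  have "real_distribution (extremal_distribution b)"
    unfolding extremal_distribution_def real_distribution_def real_distribution_axioms_def
    by (simp add: prob_space.prob_space_distr[OF prob_space_measure_pmf])
  moreover have "measure (extremal_distribution b) {reward_low b..reward_high b} = 1"
  proof -
    have "?f -` {reward_low b..reward_high b} = UNIV" using bounds by auto
    then show ?thesis by (simp add: measure)
  qed
  moreover have "(\<integral>t. t \<partial>extremal_distribution b) = prior_mean b"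
    using q(3) bounds(4) by (simp add: integral algebra_simps)
  ultimately show "feasible_distribution b (extremal_distribution b)"
    by (simp add: feasible_distribution_def)
  show "(\<integral>t. max 0 (t - z_low b) \<partial>extremal_distribution b) = cost b"
    using q(3) bounds by (subst integral) (auto simp: mult.commute)
  show "AE t in extremal_distribution b. z_low b \<le> t"
    unfolding extremal_distribution_def using bounds by (subst AE_distr_iff) auto
  have "?f -` {..z_low b} = {False}" using bounds by auto
  then show "measure (extremal_distribution b) {..z_low b} = continuation_prob b"
    using q(1,2) by (simp add: measure measure_pmf_single)
qed

section \<open>Identification\<close>

lemma joint_law_cong:
  "(\<And>i. i \<in> {1..n} \<Longrightarrow> F i = F' i) \<Longrightarrow> joint_law n F = joint_law n F'"
  unfolding joint_law_def by (intro arg_cong2[where f = pair_measure] PiM_cong refl)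

lemma joint_law_determines:
  assumes "joint_law n F = joint_law n F'"
  shows "search_behavior n F \<sigma> = search_behavior n F' \<sigma>"
    "optimal_strategy n \<gamma> F \<sigma> \<longleftrightarrow> optimal_strategy n \<gamma> F' \<sigma>"
  by (simp_all add: search_behavior_def optimal_strategy_def expected_payoff_def assms)

lemma feasible_search_behavior_necessary:
  assumes n: "0 < n"
    and b: "admissible_box b" and \<gamma>: "\<And>i. i \<in> {1..n} \<Longrightarrow> \<gamma> i = b"
    and v: "v \<in> feasible_search_behaviors n \<gamma>"
  shows "1 \<le> (\<Sum>i=1..n. v i)"
    "k \<in> {1..n} \<Longrightarrow> (\<Sum>i=1..k. v i) \<le> (\<Sum>j<k. continuation_prob b ^ j)"
proof -
  obtain F \<sigma> where F: "feasible_profile n \<gamma> F" and \<sigma>: "optimal_strategy n \<gamma> F \<sigma>"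
    and v_eq: "v = search_behavior n F \<sigma>"
    using v by (auto simp: feasible_search_behaviors_def)
  \<comment> \<open>Feasibility says nothing about \<open>F\<close> outside \<open>{1..n}\<close>; a
    point mass there meets the locale assumptions and leaves the joint law unchanged.\<close>
  define F' where "F' i = (if i \<in> {1..n} then F i else return borel 0)" for i
  have F_feasible: "feasible_distribution b (F' i)" if "i \<in> {1..n}" for i
    using F that \<gamma> by (auto simp: feasible_profile_def F'_def)
  have law: "joint_law n F = joint_law n F'"
    by (rule joint_law_cong) (simp add: F'_def)
  have "\<exists>z. \<forall>i\<in>{1..n}. (\<integral>t. max 0 (t - z i) \<partial>F' i) = cost b \<and>
      1 - continuation_prob b \<le> measure (F' i) {z i<..}"
    using reservation_value_exists[OF b F_feasible] by (intro bchoice) blast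
  then obtain z where z: "\<And>i. i \<in> {1..n} \<Longrightarrow> (\<integral>t. max 0 (t - z i) \<partial>F' i) = cost b"
    "\<And>i. i \<in> {1..n} \<Longrightarrow> 1 - continuation_prob b \<le> measure (F' i) {z i<..}" by blast
  interpret pandora_search n \<gamma> F' z
  proof (rule pandora_search.intro[OF n])
    show "real_distribution (F' i)" for i
    proof (cases "i \<in> {1..n}")
      case True
      then show ?thesis using F_feasible by (simp add: feasible_distribution_def)
    next
      case False
      then have "F' i = return borel 0" unfolding F'_def by (rule if_not_P)
      then show ?thesis
        by (simp add: real_distribution_def real_distribution_axioms_def prob_space_return)
    qed
    show "integrable (F' i) (\<lambda>t. t)" if "i \<in> {1..n}" for i
      by (rule feasible_distribution_integrable[OF F_feasible[OF that]])
    show "(\<integral>t. max 0 (t - z i) \<partial>F' i) = cost (\<gamma> i)" if "i \<in> {1..n}" for i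
      using z(1) \<gamma> that by simp
  qed
  have opt: "optimal_strategy n \<gamma> F' \<sigma>" using \<sigma> joint_law_determines(2)[OF law] by simp
  have v_open: "v i = open_prob \<sigma> i" if "i \<in> {1..n}" for i
    using that by (simp add: v_eq joint_law_determines(1)[OF law] search_behavior_eq)
  then show "1 \<le> (\<Sum>i=1..n. v i)"
    using sum_open_prob_ge_1 opt by (simp add: optimal_strategy_def)
  show "(\<Sum>i=1..k. v i) \<le> (\<Sum>j<k. continuation_prob b ^ j)" if k: "k \<in> {1..n}"
  proof -
    have "(\<Sum>i=1..k. v i) = (\<Sum>i=1..k. open_prob \<sigma> i)"
      using k v_open by (intro sum.cong) auto
    also have "\<dots> \<le> (\<Sum>r<card {1..k}. (1 - (1 - continuation_prob b)) ^ r)"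
      using k z(2) \<gamma> admissible_box_bounds(1)[OF b] continuation_prob_bounds[OF b]
      by (intro sum_open_prob_le[OF opt]) auto
    finally show ?thesis by simp
  qed
qed

text \<open>The weights of the mixture become the law of a random list, drawn once before the
  search; every box has the extremal distribution.\<close>

lemma feasible_search_behavior_sufficient:
  assumes n: "0 < n"
    and b: "admissible_box b" and \<gamma>: "\<And>i. i \<in> {1..n} \<Longrightarrow> \<gamma> i = b"
    and v: "v \<in> extensional {1..n}" "v \<in> list_mixtures n (continuation_prob b)"
  shows "v \<in> feasible_search_behaviors n \<gamma>"
proof -
  let ?p = "continuation_prob b"
  obtain a where a: "\<And>xs. xs \<in> valid_lists n \<Longrightarrow> 0 \<le> a xs" "(\<Sum>xs\<in>valid_lists n. a xs) = 1"
    "\<And>i. i \<in> {1..n} \<Longrightarrow> v i = (\<Sum>xs\<in>valid_lists n. a xs * list_behavior ?p xs i)"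
    using v(2) unfolding list_mixtures_def by blast
  obtain X where X: "X \<in> borel \<rightarrow>\<^sub>M count_space UNIV" "\<And>u. X u \<in> valid_lists n"
    "\<And>xs. xs \<in> valid_lists n \<Longrightarrow> measure (uniform_measure lborel {0..1::real}) {u. X u = xs} = a xs"
    using finite_law_uniform[OF finite_valid_lists a(1,2)] by blast
  define F where "F = (\<lambda>_ :: nat. extremal_distribution b)"
  define z where "z = (\<lambda>_ :: nat. z_low b)"
  define \<sigma> where "\<sigma> u = list_rule (X u) z" for u
  note props = extremal_distribution_props[OF b]
  interpret pandora_search n \<gamma> F z
    by (rule pandora_search.intro[OF n])
      (use props(1,2) feasible_distribution_integrable[OF props(1)] \<gamma> in
        \<open>simp_all add: F_def z_def feasible_distribution_def\<close>)
  have "feasible_profile n \<gamma> F" using props(1) \<gamma> by (simp add: feasible_profile_def F_def)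
  moreover have "optimal_strategy n \<gamma> F \<sigma>"
    unfolding \<sigma>_def[abs_def]
    by (rule optimal_list_mixture[OF X(1,2), where zl = "z_low b"]) (simp_all only: z_def F_def props(3))
  moreover have "v = search_behavior n F \<sigma>"
  proof (rule extensionalityI[OF v(1)])
    fix i assume i: "i \<in> {1..n}"
    have "open_prob \<sigma> i = (\<Sum>xs\<in>valid_lists n.
        measure (uniform_measure lborel {0..1}) {u. X u = xs} * list_behavior ?p xs i)"
      unfolding \<sigma>_def[abs_def]
      by (rule open_prob_list_mixture[OF X(1,2) i, where zl = "z_low b"])
        (use props(4) in \<open>simp_all add: z_def F_def\<close>)
    also have "\<dots> = v i" using X(3) a(3)[OF i] by simp
    finally show "v i = search_behavior n F \<sigma> i" using i by (simp add: search_behavior_eq)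
  qed (simp add: search_behavior_def)
  ultimately show ?thesis by (auto simp: feasible_search_behaviors_def)
qed

theorem proposition3:
  fixes n :: nat and v :: "nat \<Rightarrow> real" and \<Gamma> :: "(nat \<Rightarrow> box) set"
  assumes "n \<ge> 2"
    and "\<Gamma> \<subseteq> admissible_profiles n"
    and "v \<in> extensional {1..n}"
    and "\<And>i j. 1 \<le> i \<Longrightarrow> i \<le> j \<Longrightarrow> j \<le> n \<Longrightarrow> v i \<ge> v j"
    and "v n \<ge> 0"
  shows "identified_set n v (symmetric_profiles n \<Gamma>) =
    {\<gamma> \<in> symmetric_profiles n \<Gamma>.
       (\<Sum>i=1..n. v i) \<ge> 1 \<and>
       (\<forall>k\<in>{1..n}. (\<Sum>j=1..k. v j) \<le> (\<Sum>j=1..k. continuation_prob (\<gamma> 1) ^ (j - 1)))}"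
proof -
  have "v \<in> feasible_search_behaviors n \<gamma> \<longleftrightarrow> (\<Sum>i=1..n. v i) \<ge> 1 \<and>
      (\<forall>k\<in>{1..n}. (\<Sum>j=1..k. v j) \<le> (\<Sum>j=1..k. continuation_prob (\<gamma> 1) ^ (j - 1)))"
    if "\<gamma> \<in> symmetric_profiles n \<Gamma>" for \<gamma>
  proof -
    have "\<exists>b. \<forall>i\<in>{1..n}. \<gamma> i = b" using that unfolding symmetric_profiles_def by blast
    then obtain b where \<gamma>: "\<And>i. i \<in> {1..n} \<Longrightarrow> \<gamma> i = b" by blast
    have "\<gamma> \<in> {1..n} \<rightarrow>\<^sub>E Collect admissible_box"
      using that assms(2) by (auto simp: symmetric_profiles_def admissible_profiles_def)
    then have "admissible_box (\<gamma> 1)" using assms(1) by (auto simp: PiE_iff)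
    then have b: "admissible_box b" using \<gamma>[of 1] assms(1) by simp
    \<comment> \<open>\<open>\<gamma> 1\<close> stands for the common box, and the exponents
      \<open>j - 1\<close> run from 0.\<close>
    have reindex: "(\<Sum>j=1..k. continuation_prob (\<gamma> 1) ^ (j - 1)) = (\<Sum>j<k. continuation_prob b ^ j)" for k
      using \<gamma>[of 1] assms(1) by (simp add: sum.atLeast1_atMost_eq)
    show ?thesis
      unfolding reindex
    proof (intro iffI conjI ballI)
      assume v: "v \<in> feasible_search_behaviors n \<gamma>"
      show "1 \<le> (\<Sum>i=1..n. v i)"
        using assms(1) by (intro feasible_search_behavior_necessary(1)[OF _ b \<gamma> v]) auto
      show "(\<Sum>j=1..k. v j) \<le> (\<Sum>j<k. continuation_prob b ^ j)" if "k \<in> {1..n}" for k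
        using assms(1) that by (intro feasible_search_behavior_necessary(2)[OF _ b \<gamma> v]) auto
    next
      assume v: "1 \<le> (\<Sum>i=1..n. v i) \<and>
          (\<forall>k\<in>{1..n}. (\<Sum>j=1..k. v j) \<le> (\<Sum>j<k. continuation_prob b ^ j))"
      have "v \<in> list_mixtures n (continuation_prob b)"
        using continuation_prob_bounds(1)[OF b] v
        by (intro submajorized_in_list_mixtures assms(1,4,5)) auto
      then show "v \<in> feasible_search_behaviors n \<gamma>"
        using assms(1) by (intro feasible_search_behavior_sufficient[OF _ b \<gamma> assms(3)]) auto
    qed
  qed
  then show ?thesis by (auto simp: identified_set_def)
qed

end
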